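(* Let $f,g,h,R$ satisfy the standing assumptions on the data listed in the context, let $v^*$ be the optimal value function, and let $\Omega\subset\mathbb{R}^{N}$ be a domain containing the origin. Suppose $v^*\in C^1(\Omega,\mathbb{R})$. Let $v\in C^{1}(\Omega,\mathbb{R})$ be such that (1) $v$ is positive semidefinite, i.e., $v(x)\ge 0$ for all $x\in\Omega$ and $v(0)=0$; (2) the Hamilton-Jacobi-Bellman identity holds: $$\bigl\langle f(x)+g(x)u_{v}(x),\nabla v(x)\bigr\rangle + h(x) + \|u_{v}(x)\|_{R}^2 = 0\qquad\text{for all } x\in\Omega,$$ where $u_{v}(x) := -\tfrac12\,R^{-1} g(x)^{\top}\nabla v(x)$. Then there exists a set $\tilde{\Omega}\subset\Omega$ containing a neighborhood of the origin such that $v(x)=v^{*}(x)$ for all $x\in\tilde{\Omega}$. In particular, $u_v$ is an optimal feedback on $\tilde{\Omega}$.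
   Context: Let $N,M\in\mathbb{N}$. $\langle\cdot,\cdot\rangle$ is the Euclidean inner product, $\|\cdot\|$ the Euclidean norm, and $\|y\|_A:=\sqrt{\langle y,Ay\rangle}$ for symmetric positive definite $A$. A domain is a nonempty, open, connected subset of $\mathbb{R}^N$. Standing assumptions on the data: $f\in C^1(\mathbb{R}^N,\mathbb{R}^N)$, $g\in C^1(\mathbb{R}^N,\mathbb{R}^{N\times M})$, $h\in C^1(\mathbb{R}^N,\mathbb{R})$, $R\in\mathbb{R}^{M\times M}$ is symmetric positive definite, $f(0)=0$, $h(0)=0$ and $h(x)>0$ for all $x\ne0$. Optimal control problem: let $\mathcal{U}_\infty:=L^\infty([0,\infty);\mathbb{R}^M)$. For $x\in\mathbb{R}^N$ and $\mathbf{u}\in\mathcal{U}_\infty$ let $\mathbf{x}_{\mathbf{u}}(\cdot;x)$ be the unique maximal Carathéodory solution of $\dot{\mathbf{x}}_{\mathbf{u}}(t;x)=f(\mathbf{x}_{\mathbf{u}}(t;x))+g(\mathbf{x}_{\mathbf{u}}(t;x))\mathbf{u}(t)$, $\mathbf{x}_{\mathbf{u}}(0;x)=x$. Put $$J_\infty(x,\mathbf{u}):=\int_0^\infty h(\mathbf{x}_{\mathbf{u}}(t;x))+\langle\mathbf{u}(t),R\mathbf{u}(t)\rangle\,dt,$$ with $J_\infty(x,\mathbf{u}):=+\infty$ if the trajectory blows up in finite time. The optimal value function is $v^*(x):=\inf_{\mathbf{u}\in\mathcal{U}_\infty}J_\infty(x,\mathbf{u})$ (allowed to be $+\infty$ in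 general). "$v^*\in C^1(\Omega,\mathbb{R})$" means that $v^*$ is finite on $\Omega$ and its restriction to $\Omega$ is continuously differentiable. A continuous feedback $u:\Omega\to\mathbb{R}^M$ is an optimal feedback on a set $S\subset\Omega$ if for every $x\in S$ the closed-loop trajectory (maximal classical solution) of $\dot{\mathbf{x}}_u(t;x)=f(\mathbf{x}_u(t;x))+g(\mathbf{x}_u(t;x))u(\mathbf{x}_u(t;x))$, $\mathbf{x}_u(0;x)=x$, exists for all $t\ge0$, the control signal $t\mapsto u(\mathbf{x}_u(t;x))$ lies in $\mathcal{U}_\infty$, and its cost $J_\infty$ equals $v^*(x)$. *)

theory Defs
  imports "HOL-Analysis.Analysis"
begin

(* Meant for open S only: differentiability is taken with respect to the full neighbourhood. *)
definition C1_on ::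
  "('a::real_normed_vector \<Rightarrow> 'b::real_normed_vector) \<Rightarrow> 'a set \<Rightarrow> bool" where
  "C1_on f S \<longleftrightarrow>
     (\<exists>f' :: 'a \<Rightarrow> 'a \<Rightarrow>\<^sub>L 'b.
        (\<forall>x\<in>S. (f has_derivative blinfun_apply (f' x)) (at x)) \<and> continuous_on S f')"

definition grad :: "('a::real_inner \<Rightarrow> real) \<Rightarrow> 'a \<Rightarrow> 'a" where
  "grad v x = (THE D. GDERIV v x :> D)"

definition sym_pos_def :: "real ^ 'm ^ 'm \<Rightarrow> bool" where
  "sym_pos_def A \<longleftrightarrow> transpose A = A \<and> (\<forall>y. y \<noteq> 0 \<longrightarrow> y \<bullet> (A *v y) > 0)"

definition weighted_norm :: "real ^ 'm ^ 'm \<Rightarrow> real ^ 'm \<Rightarrow> real" where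
  "weighted_norm A y = sqrt (y \<bullet> (A *v y))"

definition domain_set :: "('a::topological_space) set \<Rightarrow> bool" where
  "domain_set S \<longleftrightarrow> S \<noteq> {} \<and> open S \<and> connected S"

(* The finite families of nonoverlapping compact subintervals of the usual epsilon-delta
   definition are the divisions of their own union. *)
definition abs_cont_on :: "real \<Rightarrow> real \<Rightarrow> (real \<Rightarrow> 'a::real_normed_vector) \<Rightarrow> bool" where
  "abs_cont_on a b x \<longleftrightarrow>
     (\<forall>\<epsilon>>0. \<exists>\<delta>>0. \<forall>D.
        D division_of \<Union>D \<and> \<Union>D \<subseteq> {a..b} \<and> (\<Sum>K\<in>D. Sup K - Inf K) < \<delta>
          \<longrightarrow> (\<Sum>K\<in>D. norm (x (Sup K) - x (Inf K))) < \<epsilon>)"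

(* The half-open time interval from 0 to T, where T may be infinite. *)
definition time_interval :: "ereal \<Rightarrow> real set" where
  "time_interval T = {t. 0 \<le> t \<and> ereal t < T}"

(* P T x means that x solves the initial value problem on time_interval T; the values of x
   outside that interval are irrelevant. *)
definition maximal_solution ::
  "(ereal \<Rightarrow> (real \<Rightarrow> 'a) \<Rightarrow> bool) \<Rightarrow> ereal \<Rightarrow> (real \<Rightarrow> 'a) \<Rightarrow> bool" where
  "maximal_solution P T x \<longleftrightarrow>
     P T x \<and> (\<forall>T' y. P T' y \<and> T \<le> T' \<and> (\<forall>t\<in>time_interval T. y t = x t) \<longrightarrow> T' = T)"

definition caratheodory_solution ::
  "(real ^ 'n \<Rightarrow> real ^ 'n) \<Rightarrow> (real ^ 'n \<Rightarrow> real ^ 'm ^ 'n) \<Rightarrow> (real \<Rightarrow> real ^ 'm) \<Rightarrow>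
   real ^ 'n \<Rightarrow> ereal \<Rightarrow> (real \<Rightarrow> real ^ 'n) \<Rightarrow> bool" where
  "caratheodory_solution f g u x0 T x \<longleftrightarrow>
     0 < T \<and> x 0 = x0 \<and>
     (\<forall>t\<in>time_interval T. abs_cont_on 0 t x) \<and>
     (AE t in lebesgue. t \<in> time_interval T \<longrightarrow>
        (x has_vector_derivative f (x t) + g (x t) *v u t) (at t))"

(* Representatives of the classes in L-infinity([0,\<infinity>)); values at negative times are irrelevant. *)
definition U_inf :: "(real \<Rightarrow> real ^ 'm) set" where
  "U_inf = {u. u \<in> borel_measurable (lebesgue_on {0..}) \<and>
               (\<exists>C. AE t in lebesgue_on {0..}. norm (u t) \<le> C)}"

(* The maximal trajectory is global precisely if there is a maximal solution with T = \<infinity>; it is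
   then unique on [0,\<infinity>). The integrand is nonnegative under the standing assumptions, so ennreal
   loses nothing. *)
definition cost ::
  "(real ^ 'n \<Rightarrow> real ^ 'n) \<Rightarrow> (real ^ 'n \<Rightarrow> real ^ 'm ^ 'n) \<Rightarrow> (real ^ 'n \<Rightarrow> real) \<Rightarrow>
   real ^ 'm ^ 'm \<Rightarrow> real ^ 'n \<Rightarrow> (real \<Rightarrow> real ^ 'm) \<Rightarrow> ennreal" where
  "cost f g h R x0 u =
     (if \<exists>x. maximal_solution (caratheodory_solution f g u x0) \<infinity> x
      then let x = (SOME x. maximal_solution (caratheodory_solution f g u x0) \<infinity> x)
           in \<integral>\<^sup>+t\<in>{0..}. ennreal (h (x t) + u t \<bullet> (R *v u t)) \<partial>lebesgue
      else \<infinity>)"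

definition opt_value ::
  "(real ^ 'n \<Rightarrow> real ^ 'n) \<Rightarrow> (real ^ 'n \<Rightarrow> real ^ 'm ^ 'n) \<Rightarrow> (real ^ 'n \<Rightarrow> real) \<Rightarrow>
   real ^ 'm ^ 'm \<Rightarrow> real ^ 'n \<Rightarrow> ennreal" where
  "opt_value f g h R x0 = (INF u\<in>U_inf. cost f g h R x0 u)"

(* The feedback is defined on \<Omega> only, so solutions have to stay in \<Omega>. *)
definition closed_loop_solution ::
  "(real ^ 'n \<Rightarrow> real ^ 'n) \<Rightarrow> (real ^ 'n \<Rightarrow> real ^ 'm ^ 'n) \<Rightarrow> (real ^ 'n) set \<Rightarrow>
   (real ^ 'n \<Rightarrow> real ^ 'm) \<Rightarrow> real ^ 'n \<Rightarrow> ereal \<Rightarrow> (real \<Rightarrow> real ^ 'n) \<Rightarrow> bool" where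
  "closed_loop_solution f g \<Omega> u x0 T x \<longleftrightarrow>
     0 < T \<and> x 0 = x0 \<and>
     (\<forall>t\<in>time_interval T. x t \<in> \<Omega> \<and>
        (x has_vector_derivative f (x t) + g (x t) *v u (x t)) (at t within time_interval T))"

(* A merely continuous feedback need not have a unique closed-loop trajectory; a maximal one must
   exist, and every maximal one must be global and optimal. *)
definition optimal_feedback ::
  "(real ^ 'n \<Rightarrow> real ^ 'n) \<Rightarrow> (real ^ 'n \<Rightarrow> real ^ 'm ^ 'n) \<Rightarrow> (real ^ 'n \<Rightarrow> real) \<Rightarrow>
   real ^ 'm ^ 'm \<Rightarrow> (real ^ 'n) set \<Rightarrow> (real ^ 'n \<Rightarrow> real ^ 'm) \<Rightarrow> (real ^ 'n) set \<Rightarrow> bool" where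
  "optimal_feedback f g h R \<Omega> u S \<longleftrightarrow>
     continuous_on \<Omega> u \<and> S \<subseteq> \<Omega> \<and>
     (\<forall>x0\<in>S.
        (\<exists>T x. maximal_solution (closed_loop_solution f g \<Omega> u x0) T x) \<and>
        (\<forall>T x. maximal_solution (closed_loop_solution f g \<Omega> u x0) T x \<longrightarrow>
           T = \<infinity> \<and>
           (\<lambda>t. u (x t)) \<in> U_inf \<and>
           cost f g h R x0 (\<lambda>t. u (x t)) = opt_value f g h R x0))"

definition hjb_feedback ::
  "(real ^ 'n \<Rightarrow> real ^ 'm ^ 'n) \<Rightarrow> real ^ 'm ^ 'm \<Rightarrow> (real ^ 'n \<Rightarrow> real) \<Rightarrow>
   real ^ 'n \<Rightarrow> real ^ 'm" where
  "hjb_feedback g R v x =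
     - (1 / 2) *\<^sub>R (matrix_inv R *v (transpose (g x) *v grad v x))"

end

theory Submission
  imports Defs "HOL-Complex_Analysis.Great_Picard"
begin

text \<open>By completing the square, the Hamilton-Jacobi-Bellman identity says that along any trajectory
  staying in \<open>\<Omega>\<close> the quantity \<open>v\<close> plus the accumulated cost is nondecreasing, and that it is constant
  along the closed loop. At a zero of \<open>v\<close> the gradient vanishes, so the identity forces \<open>h = 0\<close>: hence
  \<open>v\<close> is positive definite, and since it decreases along the closed loop its small sublevel sets are
  invariant. Peano's theorem then gives global closed-loop trajectories, of cost at most \<open>v\<close>.
  Conversely, on an annulus around the origin the speed of a trajectory is at most a constant times
  the running cost, so leaving a ball has a minimal price. A control cheaper than \<open>v\<close> would thus keep
  the trajectory in a ball inside \<open>\<Omega>\<close>; finite cost makes \<open>v\<close> arbitrarily small along it, and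
  monotonicity yields that the cost is at least \<open>v\<close> after all.\<close>

section \<open>Absolutely continuous functions\<close>

text \<open>The shape of the proof is dictated by regularity. \<open>v\<close> is only C1, so the
  feedback is only continuous: closed-loop trajectories need not be unique, and optimality must be
  shown for every maximal one. For a fixed signal in \<open>U_inf\<close>, trajectories are unique
  by Gronwall; hence \<open>cost\<close>, which evaluates a chosen trajectory, gives the cost of a
  closed-loop trajectory read as an open-loop one. Open-loop trajectories are differentiable only
  almost everywhere, so the fundamental theorem is proved for absolutely continuous functions,
  directly for the gauge integral. Bounded controls make trajectories Lipschitz on compact time
  intervals, so \<open>v\<close> along them is absolutely continuous too. Good initial states form
  \<open>basin\<close>, the part of a ball of radius \<rho> where \<open>v < c\<close>. The level
  \<open>c\<close> has two duties: being at most the minimum of \<open>v\<close> on the sphere, it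
  makes the basin invariant; being at most \<rho> / K, the price of crossing the annulus from \<rho>
  to 2 \<rho>, it confines every control cheaper than \<open>v\<close>.\<close>

lemma sum_length_division_less:
  fixes D :: "real set set"
  assumes D: "D division_of \<Union>D" and sub: "\<Union>D \<subseteq> T"
    and T: "T \<in> lmeasurable" "measure lebesgue T < \<delta>"
  shows "(\<Sum>K\<in>D. Sup K - Inf K) < \<delta>"
proof -
  have len: "Sup K - Inf K = measure lborel K" if K: "K \<in> D" for K
  proof -
    obtain u v where "K = cbox u v" "K \<noteq> {}"
      using division_ofD(3,4)[OF D K] by blast
    then show ?thesis by simp
  qed
  \<comment> \<open>Members of a division do not overlap, so their lengths add up to the measure of
    the union, which the covering set \<open>T\<close> bounds.\<close>
  have "((\<lambda>x. 1::real) has_integral (\<Sum>K\<in>D. measure lborel K)) (\<Union>D)"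
  proof (rule has_integral_combine_division[OF D])
    fix K assume "K \<in> D"
    then obtain u v where "K = cbox u v" using division_ofD(4)[OF D] by blast
    then show "((\<lambda>x. 1::real) has_integral measure lborel K) K"
      using has_integral_const[of "1::real" u v] by simp
  qed
  then have "\<Union>D \<in> lmeasurable" "(\<Sum>K\<in>D. measure lborel K) = measure lebesgue (\<Union>D)"
    using lmeasurable_iff_integrable_on[of "\<Union>D"] lmeasure_integral[of "\<Union>D"] by (auto simp: has_integral_iff)
  moreover have "measure lebesgue (\<Union>D) \<le> measure lebesgue T"
    using measure_mono_fmeasurable[OF sub] calculation(1) T(1) by (simp add: fmeasurableD)
  ultimately show ?thesis using T len by (simp cong: sum.cong)
qed

text \<open>The gauge may depend on the tag, so the null set \<open>E\<close> is treated inside the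
  Riemann sum: there a small open cover meets absolute continuity. Integrability of \<open>F\<close>
  comes out together with the value.\<close>

theorem has_integral_abs_cont_on:
  fixes y :: "real \<Rightarrow> 'a::real_normed_vector"
  assumes "a \<le> b" and ac: "abs_cont_on a b y" and "negligible E"
    and der: "\<And>t. t \<in> {a..b} - E \<Longrightarrow> (y has_vector_derivative F t) (at t within {a..b})"
  shows "(F has_integral y b - y a) {a..b}"
proof (rule has_integral_spike[OF \<open>negligible E\<close>])
  \<comment> \<open>\<open>F\<close> is arbitrary on \<open>E\<close>. With the value 0 there,
    intervals tagged in \<open>E\<close> add nothing to the Riemann sum, and only their increments
    of \<open>y\<close> need a bound.\<close>
  let ?F = "\<lambda>t. if t \<in> E then 0 else F t"
  show "F x = ?F x" if "x \<in> {a..b} - E" for x using that by simp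
  show "(?F has_integral y b - y a) {a..b}"
    unfolding has_integral_real
  proof (intro allI impI)
    fix e :: real assume "e > 0"
    \<comment> \<open>The \<open>+ 1\<close> keeps \<open>c\<close> positive when
      \<open>a = b\<close>. All tags outside \<open>E\<close> together cost at most
      \<open>e / 3\<close>, which leaves \<open>e / 2\<close> for those in \<open>E\<close>.\<close>
    define c where "c = b - a + 1"
    define e' where "e' = e / (3 * c)"
    have "c > 0" using \<open>a \<le> b\<close> by (simp add: c_def)
    then have "e' > 0" using \<open>e > 0\<close> by (simp add: e'_def)
    have e'ba: "e' * (b - a) < e / 2"
    proof -
      have "e' * (b - a) \<le> e' * c" using \<open>e' > 0\<close> by (simp add: c_def)
      also have "\<dots> = e / 3" using \<open>c > 0\<close> by (simp add: e'_def)
      finally show ?thesis using \<open>e > 0\<close> by simp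
    qed
    obtain \<delta> where "\<delta> > 0" and \<delta>: "\<And>D. D division_of \<Union>D \<Longrightarrow> \<Union>D \<subseteq> {a..b} \<Longrightarrow>
        (\<Sum>K\<in>D. Sup K - Inf K) < \<delta> \<Longrightarrow> (\<Sum>K\<in>D. norm (y (Sup K) - y (Inf K))) < e / 2"
      using ac \<open>e > 0\<close> unfolding abs_cont_on_def by (meson half_gt_zero)
    have E0: "E \<in> null_sets lebesgue" using \<open>negligible E\<close> by (simp add: negligible_iff_null_sets)
    obtain T where T: "open T" "E \<subseteq> T" "T - E \<in> lmeasurable" "emeasure lebesgue (T - E) < ennreal \<delta>"
      using sets_lebesgue_outer_open[of E \<delta>] E0 \<open>\<delta> > 0\<close> by auto
    \<comment> \<open>The outer open set is small only up to \<open>E\<close>; putting the null set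
      back does not change its measure.\<close>
    have T': "T \<in> lmeasurable" "measure lebesgue T < \<delta>"
    proof -
      have "T = (T - E) \<union> E" using T by auto
      moreover have "E \<in> lmeasurable" using negligible_imp_measurable \<open>negligible E\<close> by blast
      ultimately show "T \<in> lmeasurable" using T(3) by (metis fmeasurable.Un)
      then have "measure lebesgue T = measure lebesgue (T - E)"
        using measure_Diff_null_set[OF _ E0] by (simp add: fmeasurableD E0)
      also have "\<dots> < \<delta>"
        using T(3,4) \<open>\<delta> > 0\<close> by (simp add: emeasure_eq_measure2 ennreal_less_iff)
      finally show "measure lebesgue T < \<delta>" .
    qed
    have "\<exists>d>0. \<forall>s\<in>{a..b}. \<bar>s - t\<bar> < d \<longrightarrow> norm (y s - y t - (s - t) *\<^sub>R F t) \<le> e' * \<bar>s - t\<bar>"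
      if "t \<in> {a..b} - E" for t
      using der[OF that] \<open>e' > 0\<close>
      unfolding has_vector_derivative_def has_derivative_within_alt by auto
    then have "\<forall>t\<in>{a..b} - E. \<exists>d>0. \<forall>s\<in>{a..b}. \<bar>s - t\<bar> < d \<longrightarrow>
        norm (y s - y t - (s - t) *\<^sub>R F t) \<le> e' * \<bar>s - t\<bar>" ..
    from bchoice[OF this] obtain d where d: "\<And>t. t \<in> {a..b} - E \<Longrightarrow> d t > 0"
      "\<And>t s. t \<in> {a..b} - E \<Longrightarrow> s \<in> {a..b} \<Longrightarrow> \<bar>s - t\<bar> < d t \<Longrightarrow>
          norm (y s - y t - (s - t) *\<^sub>R F t) \<le> e' * \<bar>s - t\<bar>"
      by blast
    txt \<open>Intervals tagged in \<open>E\<close> lie in \<open>T\<close>, so absolute continuity bounds their increments; the other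
      tags are handled by differentiability.\<close>
    define \<gamma> where "\<gamma> t = (if t \<in> E then T else if t \<in> {a..b} then ball t (d t) else ball t 1)" for t
    have gauge: "gauge \<gamma>"
      using T d(1) by (auto simp: gauge_def \<gamma>_def)
    have fine_less: "norm ((\<Sum>(x, k)\<in>D. measure lborel k *\<^sub>R ?F x) - (y b - y a)) < e"
      if D: "D tagged_division_of {a..b}" and fine: "\<gamma> fine D" for D
    proof -
      have fin: "finite D" using D by blast
      let ?r = "\<lambda>(x,k). measure lborel k *\<^sub>R ?F x - (y (Sup k) - y (Inf k))"
      have "(\<Sum>(x, k)\<in>D. measure lborel k *\<^sub>R ?F x) - (y b - y a) = sum ?r D"
        unfolding additive_tagged_division_1[OF \<open>a \<le> b\<close> D, of y, symmetric]
          sum_subtractf[symmetric] by (rule sum.cong) auto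
      also have "norm \<dots> \<le> (\<Sum>p\<in>D. norm (?r p))" by (rule norm_sum)
      also have "\<dots> = (\<Sum>p\<in>{p\<in>D. fst p \<notin> E}. norm (?r p)) + (\<Sum>p\<in>{p\<in>D. fst p \<in> E}. norm (?r p))"
      proof -
        have "D = {p\<in>D. fst p \<notin> E} \<union> {p\<in>D. fst p \<in> E}" by blast
        then have "(\<Sum>p\<in>D. norm (?r p)) = (\<Sum>p\<in>{p\<in>D. fst p \<notin> E} \<union> {p\<in>D. fst p \<in> E}. norm (?r p))"
          by simp
        also have "\<dots> = (\<Sum>p\<in>{p\<in>D. fst p \<notin> E}. norm (?r p)) + (\<Sum>p\<in>{p\<in>D. fst p \<in> E}. norm (?r p))"
          by (rule sum.union_disjoint) (use fin in auto)
        finally show ?thesis .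
      qed
      finally have split: "norm ((\<Sum>(x, k)\<in>D. measure lborel k *\<^sub>R ?F x) - (y b - y a)) \<le>
          (\<Sum>p\<in>{p\<in>D. fst p \<notin> E}. norm (?r p)) + (\<Sum>p\<in>{p\<in>D. fst p \<in> E}. norm (?r p))" .
      have "(\<Sum>p\<in>{p\<in>D. fst p \<notin> E}. norm (?r p)) \<le> e' * (b - a)"
      proof -
        have "norm (?r p) \<le> e' * measure lborel (snd p)" if p: "p \<in> D" "fst p \<notin> E" for p
        proof -
          obtain x k where xk: "p = (x,k)" by (cases p)
          obtain u v where k: "k = {u..v}" "x \<in> {u..v}" "{u..v} \<subseteq> {a..b}"
            using tagged_division_ofD(2,3,4)[OF D p(1)[unfolded xk]] by (metis box_real(2))
          then have uv: "u \<le> v" "x \<in> {a..b} - E" using p xk by auto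
          have "k \<subseteq> ball x (d x)"
            using fineD[OF fine p(1)[unfolded xk]] uv by (simp add: \<gamma>_def)
          moreover have "u \<in> k" "v \<in> k" using k uv by auto
          ultimately have "u \<in> ball x (d x)" "v \<in> ball x (d x)" by blast+
          then have dist: "\<bar>u - x\<bar> < d x" "\<bar>v - x\<bar> < d x"
            by (simp_all add: dist_real_def abs_minus_commute)
          have mem: "u \<in> {a..b}" "v \<in> {a..b}" using k uv by auto
          \<comment> \<open>Straddling: the tag lies between the end points, so the errors at both
            ends add up to a multiple of \<open>(x - u) + (v - x)\<close>, the length of the
            interval.\<close>
          have "norm (y u - y x - (u - x) *\<^sub>R F x) \<le> e' * (x - u)"
            using d(2)[OF uv(2) mem(1) dist(1)] k by auto
          moreover have "norm (y v - y x - (v - x) *\<^sub>R F x) \<le> e' * (v - x)"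
            using d(2)[OF uv(2) mem(2) dist(2)] k by auto
          ultimately have "norm ((y u - y x - (u - x) *\<^sub>R F x) - (y v - y x - (v - x) *\<^sub>R F x))
              \<le> e' * (x - u) + e' * (v - x)"
            by (rule order_trans[OF norm_triangle_ineq4 add_mono])
          also have "(y u - y x - (u - x) *\<^sub>R F x) - (y v - y x - (v - x) *\<^sub>R F x)
              = (v - u) *\<^sub>R F x - (y v - y u)"
            by (simp add: scaleR_diff_left)
          also have "e' * (x - u) + e' * (v - x) = e' * (v - u)" by (simp add: right_diff_distrib)
          finally show ?thesis using xk k uv p by simp
        qed
        then have "(\<Sum>p\<in>{p\<in>D. fst p \<notin> E}. norm (?r p)) \<le> (\<Sum>p\<in>{p\<in>D. fst p \<notin> E}. e' * measure lborel (snd p))"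
          by (intro sum_mono) auto
        also have "\<dots> \<le> (\<Sum>p\<in>D. e' * measure lborel (snd p))"
          using fin \<open>e' > 0\<close> by (intro sum_mono2) auto
        also have "\<dots> = e' * (\<Sum>(x, k)\<in>D. measure lborel k)"
          unfolding sum_distrib_left by (rule sum.cong) auto
        also have "\<dots> = e' * (b - a)"
          using additive_content_tagged_division[of D a b] D \<open>a \<le> b\<close> by simp
        finally show ?thesis .
      qed
      moreover have "(\<Sum>p\<in>{p\<in>D. fst p \<in> E}. norm (?r p)) < e / 2"
      proof -
        let ?P = "{p\<in>D. fst p \<in> E}"
        \<comment> \<open>\<open>sum.over_tagged_division_lemma\<close> wants a function vanishing
          on every \<open>cbox u v\<close> with empty interior, including the empty set, where
          \<open>Sup\<close> and \<open>Inf\<close> say nothing. On members of the division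
          \<open>L\<close> is the true increment, since a degenerate interval has equal end
          points.\<close>
        define L where "L k = (if measure lborel k = 0 then 0 else norm (y (Sup k) - y (Inf k)))" for k :: "real set"
        have part: "?P tagged_partial_division_of {a..b}"
          using D tagged_partial_division_subset[of D "{a..b}" ?P] by (auto simp: tagged_division_of_def)
        have div: "snd ` ?P division_of \<Union>(snd ` ?P)"
          by (rule partial_division_of_tagged_division[OF part])
        have cont0: "L k = norm (y (Sup k) - y (Inf k))" if k: "k \<in> snd ` ?P" for k
        proof -
          obtain u v where "k = cbox u v" "k \<noteq> {}"
            using division_ofD(3,4)[OF div k] by blast
          then show ?thesis by (auto simp: L_def)
        qed
        have "(\<Sum>p\<in>?P. norm (?r p)) = (\<Sum>(x,k)\<in>?P. L k)"
        proof (rule sum.cong[OF refl])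
          fix p assume p: "p \<in> ?P"
          then have "norm (?r p) = norm (y (Sup (snd p)) - y (Inf (snd p)))"
            by (simp add: case_prod_unfold norm_minus_commute)
          then show "norm (?r p) = (case p of (x, k) \<Rightarrow> L k)"
            using cont0[of "snd p"] p by (simp add: case_prod_unfold)
        qed
        also have "\<dots> = sum L (snd ` ?P)"
          by (rule sum.over_tagged_division_lemma[OF tagged_partial_division_of_Union_self[OF part]])
            (auto simp only: L_def content_eq_0_interior interior_cbox simp_thms if_True)
        also have "\<dots> = (\<Sum>k\<in>snd ` ?P. norm (y (Sup k) - y (Inf k)))"
          by (rule sum.cong[OF refl cont0])
        also have "\<dots> < e / 2"
        proof (rule \<delta>[OF div])
          show "\<Union>(snd ` ?P) \<subseteq> {a..b}"
          proof (rule Union_least)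
            fix k assume "k \<in> snd ` ?P"
            then obtain x where "(x, k) \<in> ?P" by auto
            then show "k \<subseteq> {a..b}" by (rule tagged_partial_division_ofD(3)[OF part])
          qed
          have "\<Union>(snd ` ?P) \<subseteq> T"
          proof (rule Union_least)
            fix k assume "k \<in> snd ` ?P"
            then obtain x where x: "(x, k) \<in> D" "x \<in> E" by auto
            then show "k \<subseteq> T" using fineD[OF fine x(1)] by (simp add: \<gamma>_def)
          qed
          then show "(\<Sum>K\<in>snd ` ?P. Sup K - Inf K) < \<delta>"
            by (rule sum_length_division_less[OF div _ T'])
        qed
        finally show ?thesis .
      qed
      ultimately show ?thesis using split e'ba by linarith
    qed
    show "\<exists>\<gamma>. gauge \<gamma> \<and> (\<forall>D. D tagged_division_of {a..b} \<and> \<gamma> fine D \<longrightarrow>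
        norm ((\<Sum>(x, k)\<in>D. measure lborel k *\<^sub>R ?F x) - (y b - y a)) < e)"
    proof (intro exI[of _ \<gamma>] conjI allI impI)
      show "norm ((\<Sum>(x, k)\<in>D. measure lborel k *\<^sub>R ?F x) - (y b - y a)) < e"
        if "D tagged_division_of {a..b} \<and> \<gamma> fine D" for D
        using that by (intro fine_less) auto
    qed (fact gauge)
  qed
qed

lemma abs_cont_on_subinterval:
  "abs_cont_on a b y \<Longrightarrow> a \<le> c \<Longrightarrow> d \<le> b \<Longrightarrow> abs_cont_on c d y"
  unfolding abs_cont_on_def by (meson atLeastatMost_subset_iff subset_trans)

lemma lipschitz_on_imp_abs_cont_on:
  fixes y :: "real \<Rightarrow> 'a::real_normed_vector"
  assumes lip: "C-lipschitz_on {a..b} y"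
  shows "abs_cont_on a b y"
  unfolding abs_cont_on_def
proof (intro allI impI)
  fix e :: real assume "e > 0"
  have C: "C \<ge> 0" using lip by (rule lipschitz_on_nonneg)
  show "\<exists>\<delta>>0. \<forall>D. D division_of \<Union>D \<and> \<Union>D \<subseteq> {a..b} \<and> (\<Sum>K\<in>D. Sup K - Inf K) < \<delta>
          \<longrightarrow> (\<Sum>K\<in>D. norm (y (Sup K) - y (Inf K))) < e"
  proof (intro exI conjI allI impI)
    show "e / (C + 1) > 0" using C \<open>e > 0\<close> by simp
    fix D assume D: "D division_of \<Union>D \<and> \<Union>D \<subseteq> {a..b} \<and> (\<Sum>K\<in>D. Sup K - Inf K) < e / (C + 1)"
    have *: "0 \<le> Sup K - Inf K \<and> norm (y (Sup K) - y (Inf K)) \<le> C * (Sup K - Inf K)" if K: "K \<in> D" for K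
    proof -
      obtain u v where uv: "K = {u..v}" "u \<le> v"
        using division_ofD(3,4)[of D "\<Union>D" K] D K by fastforce
      then have "{u..v} \<subseteq> {a..b}" using D K by blast
      then have "u \<in> {a..b}" "v \<in> {a..b}" using uv by auto
      then show ?thesis
        using lipschitz_onD[OF lip, of v u] uv by (simp add: dist_norm)
    qed
    then have "(\<Sum>K\<in>D. norm (y (Sup K) - y (Inf K))) \<le> C * (\<Sum>K\<in>D. Sup K - Inf K)"
      unfolding sum_distrib_left by (intro sum_mono) auto
    also have "\<dots> \<le> (C + 1) * (\<Sum>K\<in>D. Sup K - Inf K)"
      using * by (intro mult_right_mono sum_nonneg) auto
    also have "\<dots> < e"
      using D C by (simp add: field_simps)
    finally show "(\<Sum>K\<in>D. norm (y (Sup K) - y (Inf K))) < e" .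
  qed
qed

lemma abs_cont_on_imp_continuous_on:
  fixes y :: "real \<Rightarrow> 'a::real_normed_vector"
  assumes ac: "abs_cont_on a b y"
  shows "continuous_on {a..b} y"
  unfolding continuous_on_iff
proof (intro ballI allI impI)
  fix t e :: real assume t: "t \<in> {a..b}" and "e > 0"
  obtain \<delta> where "\<delta> > 0" and \<delta>: "\<And>D. D division_of \<Union>D \<Longrightarrow> \<Union>D \<subseteq> {a..b} \<Longrightarrow>
        (\<Sum>K\<in>D. Sup K - Inf K) < \<delta> \<Longrightarrow> (\<Sum>K\<in>D. norm (y (Sup K) - y (Inf K))) < e"
    using ac \<open>e > 0\<close> unfolding abs_cont_on_def by meson
  have *: "norm (y v - y u) < e" if "u \<le> v" "u \<in> {a..b}" "v \<in> {a..b}" "v - u < \<delta>" for u v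
  proof -
    have "{{u..v}} division_of \<Union>{{u..v}}"
      using that division_of_self[of u v] by auto
    from \<delta>[OF this] show ?thesis using that by auto
  qed
  show "\<exists>d>0. \<forall>s\<in>{a..b}. dist s t < d \<longrightarrow> dist (y s) (y t) < e"
  proof (intro exI conjI ballI impI)
    fix s assume s: "s \<in> {a..b}" "dist s t < \<delta>"
    show "dist (y s) (y t) < e"
      using *[of s t] *[of t s] s t by (cases "s \<le> t") (auto simp: dist_norm norm_minus_commute)
  qed (fact \<open>\<delta> > 0\<close>)
qed

section \<open>Peano existence theorem\<close>

text \<open>\<open>p\<close> is the step function through the Euler nodes with step size \<open>\<delta>\<close>, \<open>X\<close> the polygon.\<close>

lemma euler_polygon:
  fixes F :: "'a::euclidean_space \<Rightarrow> 'a"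
  assumes bound: "\<And>y. norm (F y) \<le> L" and "\<delta> > 0"
  obtains p X :: "real \<Rightarrow> 'a"
  where "\<And>t. t \<ge> 0 \<Longrightarrow> ((\<lambda>s. F (p s)) has_integral X t - x0) {0..t}"
    and "L-lipschitz_on {0..} X" "X 0 = x0" and "\<And>t. t \<ge> 0 \<Longrightarrow> norm (p t - X t) \<le> L * \<delta>"
proof -
  define e where "e k = ((\<lambda>y. y + \<delta> *\<^sub>R F y) ^^ k) x0" for k
  define p where "p s = e (nat \<lfloor>s / \<delta>\<rfloor>)" for s
  have L: "L \<ge> 0" using bound[of 0] norm_ge_zero order_trans by blast
  have node: "((\<lambda>s. F (p s)) has_integral e k - x0) {0..real k * \<delta>}" for k
  proof (induction k)
    case 0
    then show ?case by (simp add: e_def has_integral_refl)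
  next
    case (Suc k)
    have "((\<lambda>s. F (e k)) has_integral \<delta> *\<^sub>R F (e k)) {real k * \<delta>..real (Suc k) * \<delta>}"
      using has_integral_const_real[of "F (e k)" "real k * \<delta>" "real (Suc k) * \<delta>"] \<open>\<delta> > 0\<close>
      by (simp add: algebra_simps)
    then have "((\<lambda>s. F (p s)) has_integral \<delta> *\<^sub>R F (e k)) {real k * \<delta>..real (Suc k) * \<delta>}"
    proof (rule has_integral_spike_finite[rotated 2])
      \<comment> \<open>At the right end point the floor already jumps to \<open>k + 1\<close>; a
        single point does not affect the integral.\<close>
      fix s assume "s \<in> {real k * \<delta>..real (Suc k) * \<delta>} - {real (Suc k) * \<delta>}"
      then have "real k \<le> s / \<delta>" "s / \<delta> < real k + 1"
        using \<open>\<delta> > 0\<close> by (auto simp: field_simps)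
      then have "\<lfloor>s / \<delta>\<rfloor> = int k" by (simp add: floor_eq_iff)
      then show "F (p s) = F (e k)" by (simp add: p_def)
    qed simp
    from has_integral_combine[OF _ _ Suc this] \<open>\<delta> > 0\<close>
    have "((\<lambda>s. F (p s)) has_integral (e k - x0) + \<delta> *\<^sub>R F (e k)) {0..real (Suc k) * \<delta>}"
      by simp
    then show ?case by (simp add: e_def algebra_simps)
  qed
  have int: "(\<lambda>s. F (p s)) integrable_on {a..b}" if "0 \<le> a" for a b
  proof -
    obtain k where "b / \<delta> \<le> real k" using real_arch_simple by blast
    then have "b \<le> real k * \<delta>" using \<open>\<delta> > 0\<close> by (simp add: field_simps)
    then have "{a..b} \<subseteq> {0..real k * \<delta>}" using that by auto
    then show ?thesis using integrable_on_subinterval[OF has_integral_integrable[OF node]] by blast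
  qed
  define X where "X t = x0 + integral {0..t} (\<lambda>s. F (p s))" for t
  have diff: "norm (X t - X s) \<le> L * (t - s)" if "0 \<le> s" "s \<le> t" for s t
  proof -
    have "integral {0..s} (\<lambda>s. F (p s)) + integral {s..t} (\<lambda>s. F (p s)) = integral {0..t} (\<lambda>s. F (p s))"
      using that int by (intro Henstock_Kurzweil_Integration.integral_combine) auto
    then have "X t - X s = integral {s..t} (\<lambda>s. F (p s))" by (simp add: X_def algebra_simps)
    also have "norm \<dots> \<le> L * measure lborel (cbox s t)"
      using has_integral_bound[OF L, of "\<lambda>s. F (p s)" _ s t] int[OF \<open>0 \<le> s\<close>, of t] bound
      by (simp add: has_integral_integral)
    finally show ?thesis using that by simp
  qed
  have Xnode: "X (real k * \<delta>) = e k" for k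
    using integral_unique[OF node[of k]] by (simp add: X_def)
  show thesis
  proof
    show "((\<lambda>s. F (p s)) has_integral X t - x0) {0..t}" if "t \<ge> 0" for t
      using int[of 0 t] by (simp add: X_def has_integral_integral)
    show "L-lipschitz_on {0..} X"
    proof (rule lipschitz_onI[OF _ L])
      fix s t :: real assume "s \<in> {0..}" "t \<in> {0..}"
      then show "dist (X s) (X t) \<le> L * dist s t"
        using diff[of s t] diff[of t s] by (cases "s \<le> t") (auto simp: dist_norm norm_minus_commute)
    qed
    show "X 0 = x0" by (simp add: X_def)
    fix t :: real assume "t \<ge> 0"
    \<comment> \<open>\<open>real k * \<delta>\<close> is the last node up to \<open>t\<close>, and
      \<open>X\<close> takes the value \<open>p t\<close> there; the gap is the growth of
      \<open>X\<close> over at most one step.\<close>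
    define k where "k = nat \<lfloor>t / \<delta>\<rfloor>"
    have "real k \<le> t / \<delta>" "t / \<delta> < real k + 1"
      using \<open>t \<ge> 0\<close> \<open>\<delta> > 0\<close> by (auto simp: k_def)
    then have k: "real k * \<delta> \<le> t" "t - real k * \<delta> \<le> \<delta>"
      using \<open>\<delta> > 0\<close> by (auto simp: field_simps)
    have "norm (p t - X t) = norm (X t - X (real k * \<delta>))"
      by (simp add: Xnode p_def k_def norm_minus_commute)
    also have "\<dots> \<le> L * (t - real k * \<delta>)"
      using k \<open>\<delta> > 0\<close> by (intro diff) auto
    also have "\<dots> \<le> L * \<delta>" using k L by (intro mult_left_mono) auto
    finally show "norm (p t - X t) \<le> L * \<delta>" .
  qed
qed

text \<open>Arzela-Ascoli works on compact intervals; diagonalization over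
  \<open>{0..real i}\<close> gives one subsequence for the whole half-line. The common Lipschitz
  constant and starting point supply equicontinuity and boundedness.\<close>

lemma lipschitz_family_pointwise_convergent_subsequence:
  fixes X :: "nat \<Rightarrow> real \<Rightarrow> 'a::euclidean_space"
  assumes lip: "\<And>n. L-lipschitz_on {0..} (X n)" and X0: "\<And>n. X n 0 = x0"
  obtains k where "strict_mono (k :: nat \<Rightarrow> nat)" "\<And>t. t \<ge> 0 \<Longrightarrow> convergent (\<lambda>n. X (k n) t)"
proof -
  have L: "L \<ge> 0" using lip lipschitz_on_nonneg by blast
  let ?P = "\<lambda>i (r::nat \<Rightarrow> nat). \<forall>t\<in>{0..real i}. convergent (\<lambda>n. X (r n) t)"
  obtain k where "strict_mono (k :: nat \<Rightarrow> nat)" and k: "\<And>i. ?P i (id \<circ> k)"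
  proof (rule subsequence_diagonalization_lemma[of ?P id])
    fix i and r :: "nat \<Rightarrow> nat"
    have lipr: "norm (X (r n) s - X (r n) t) \<le> L * \<bar>s - t\<bar>" if "0 \<le> s" "0 \<le> t" for n s t
      using lipschitz_onD[OF lip[of "r n"], of s t] that by (simp add: dist_norm)
    obtain g k where "strict_mono (k :: nat \<Rightarrow> nat)" and
      k: "\<And>e. 0 < e \<Longrightarrow> \<exists>N. \<forall>n t. n \<ge> N \<and> t \<in> {0..real i} \<longrightarrow> norm (X (r (k n)) t - g t) < e"
    proof (rule Arzela_Ascoli[of "{0..real i}" "\<lambda>n. X (r n)" "norm x0 + L * real i"])
      fix n and t :: real assume t: "t \<in> {0..real i}"
      have "norm (X (r n) t) \<le> norm x0 + norm (X (r n) t - X (r n) 0)"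
        by (simp add: X0 norm_triangle_sub)
      also have "\<dots> \<le> norm x0 + L * t" using lipr[of t 0 n] t by simp
      also have "\<dots> \<le> norm x0 + L * real i" using L t by (simp add: mult_left_mono)
      finally show "norm (X (r n) t) \<le> norm x0 + L * real i" .
    next
      fix t e :: real assume t: "t \<in> {0..real i}" "0 < e"
      show "\<exists>d>0. \<forall>n s. s \<in> {0..real i} \<and> norm (t - s) < d \<longrightarrow> norm (X (r n) t - X (r n) s) < e"
      proof (intro exI conjI allI impI)
        show "e / (L + 1) > 0" using t L by simp
        fix n s assume s: "s \<in> {0..real i} \<and> norm (t - s) < e / (L + 1)"
        have "norm (X (r n) t - X (r n) s) \<le> L * \<bar>t - s\<bar>" using lipr t s by simp
        also have "\<dots> \<le> (L + 1) * \<bar>t - s\<bar>" by (simp add: mult_right_mono)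
        also have "\<dots> < e" using s L by (simp add: field_simps)
        finally show "norm (X (r n) t - X (r n) s) < e" .
      qed
    qed auto
    moreover have "?P i (r \<circ> k)"
    proof
      fix t assume t: "t \<in> {0..real i}"
      have "(\<lambda>n. X (r (k n)) t) \<longlonglongrightarrow> g t"
      proof (rule LIMSEQ_I)
        fix e :: real assume "e > 0"
        from k[OF this] t show "\<exists>N. \<forall>n\<ge>N. norm (X (r (k n)) t - g t) < e" by metis
      qed
      then show "convergent (\<lambda>n. X ((r \<circ> k) n) t)" by (auto simp: convergent_def)
    qed
    ultimately show "\<exists>k. strict_mono (k :: nat \<Rightarrow> nat) \<and> ?P i (r \<circ> k)" by blast
  next
    \<comment> \<open>A diagonal sequence is only eventually drawn from the earlier one; the limit
      survives because the index \<open>j'\<close> is at least \<open>j\<close>.\<close>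
    fix i N and r k1 k2 :: "nat \<Rightarrow> nat"
    assume conv: "?P i (r \<circ> k1)" and sub: "\<And>j. N \<le> j \<Longrightarrow> \<exists>j'. j \<le> j' \<and> k2 j = k1 j'"
    show "?P i (r \<circ> k2)"
    proof
      fix t assume "t \<in> {0..real i}"
      with conv have "convergent (\<lambda>n. X ((r \<circ> k1) n) t)" by blast
      then obtain y where y: "(\<lambda>n. X (r (k1 n)) t) \<longlonglongrightarrow> y"
        by (auto simp: convergent_def)
      have "(\<lambda>n. X (r (k2 n)) t) \<longlonglongrightarrow> y"
      proof (rule LIMSEQ_I)
        fix e :: real assume "e > 0"
        then obtain M where M: "\<And>n. n \<ge> M \<Longrightarrow> norm (X (r (k1 n)) t - y) < e"
          using LIMSEQ_D[OF y] by blast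
        have "norm (X (r (k2 n)) t - y) < e" if n: "n \<ge> max M N" for n
        proof -
          obtain j' where "n \<le> j'" "k2 n = k1 j'" using sub[of n] n by auto
          then show ?thesis using M[of j'] n by simp
        qed
        then show "\<exists>M. \<forall>n\<ge>M. norm (X (r (k2 n)) t - y) < e" by blast
      qed
      then show "convergent (\<lambda>n. X ((r \<circ> k2) n) t)" by (auto simp: convergent_def)
    qed
  qed blast
  show thesis
  proof (rule that[OF \<open>strict_mono k\<close>])
    fix t :: real assume "t \<ge> 0"
    obtain i where "t \<le> real i" using real_arch_simple by blast
    then show "convergent (\<lambda>n. X (k n) t)" using k[of i] \<open>t \<ge> 0\<close> by simp
  qed
qed

text \<open>Boundedness of \<open>F\<close> acts twice: it gives the Euler polygons a common
  Lipschitz constant, hence a limit on all of \<open>{0..}\<close>, and it dominates the integrands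
  when the limit is taken in the integral equation.\<close>

theorem peano_global:
  fixes F :: "'a::euclidean_space \<Rightarrow> 'a"
  assumes cont: "continuous_on UNIV F" and bound: "\<And>y. norm (F y) \<le> L"
  obtains x :: "real \<Rightarrow> 'a" where "x 0 = x0" "continuous_on {0..} x"
    "\<And>t. t \<ge> 0 \<Longrightarrow> ((\<lambda>s. F (x s)) has_integral x t - x0) {0..t}"
proof -
  have L: "L \<ge> 0" using bound[of 0] norm_ge_zero order_trans by blast
  \<comment> \<open>Step function and polygon form a pair, so that one choice for each
    \<open>n\<close> fixes both.\<close>
  define Q where "Q n q \<longleftrightarrow> (\<forall>t\<ge>0. ((\<lambda>s. F (fst q s)) has_integral snd q t - x0) {0..t}) \<and>
      L-lipschitz_on {0..} (snd q) \<and> snd q 0 = x0 \<and>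
      (\<forall>t\<ge>0. norm (fst q t - snd q t) \<le> L * inverse (real (Suc n)))" for n and q :: "(real \<Rightarrow> 'a) \<times> (real \<Rightarrow> 'a)"
  have "\<exists>q. Q n q" for n
  proof -
    have "inverse (real (Suc n)) > 0" by simp
    then show ?thesis
    proof (rule euler_polygon[of F L, OF bound _, of _ x0])
      fix p X :: "real \<Rightarrow> 'a"
      assume "\<And>t. t \<ge> 0 \<Longrightarrow> ((\<lambda>s. F (p s)) has_integral X t - x0) {0..t}" "L-lipschitz_on {0..} X"
        "X 0 = x0" "\<And>t. t \<ge> 0 \<Longrightarrow> norm (p t - X t) \<le> L * inverse (real (Suc n))"
      then have "Q n (p, X)" by (simp add: Q_def)
      then show ?thesis ..
    qed
  qed
  then obtain q where q: "\<And>n. Q n (q n)" by metis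
  define p where "p n = fst (q n)" for n
  define X where "X n = snd (q n)" for n
  have pX: "\<And>n t. t \<ge> 0 \<Longrightarrow> ((\<lambda>s. F (p n s)) has_integral X n t - x0) {0..t}"
    "\<And>n. L-lipschitz_on {0..} (X n)" "\<And>n. X n 0 = x0"
    "\<And>n t. t \<ge> 0 \<Longrightarrow> norm (p n t - X n t) \<le> L * inverse (real (Suc n))"
    using q by (auto simp: Q_def p_def X_def)
  obtain k where "strict_mono (k :: nat \<Rightarrow> nat)" and conv: "\<And>t. t \<ge> 0 \<Longrightarrow> convergent (\<lambda>n. X (k n) t)"
    using lipschitz_family_pointwise_convergent_subsequence[of L X x0] pX(2,3) by blast
  define x where "x t = lim (\<lambda>n. X (k n) t)" for t
  have Xx: "(\<lambda>n. X (k n) t) \<longlonglongrightarrow> x t" if "t \<ge> 0" for t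
    using conv[OF that] by (simp add: x_def convergent_LIMSEQ_iff)
  \<comment> \<open>The integrand involves \<open>p\<close>, not \<open>X\<close>; both have the
    same limit because their distance is at most \<open>L\<close> times the step size.\<close>
  have px: "(\<lambda>n. p (k n) t) \<longlonglongrightarrow> x t" if "t \<ge> 0" for t
  proof -
    have lim0: "(\<lambda>n. L * inverse (real (Suc (k n)))) \<longlonglongrightarrow> 0"
      using LIMSEQ_subseq_LIMSEQ[OF LIMSEQ_inverse_real_of_nat \<open>strict_mono k\<close>]
      by (auto intro!: tendsto_mult_right_zero simp: o_def)
    have "(\<lambda>n. p (k n) t - X (k n) t) \<longlonglongrightarrow> 0"
      by (rule Lim_null_comparison[OF always_eventually lim0]) (use pX(4)[OF that] in blast)
    from tendsto_add[OF this Xx[OF that]] show ?thesis by simp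
  qed
  show thesis
  proof (rule that[of x])
    show "x 0 = x0" using Xx[of 0] pX(3) by (simp add: LIMSEQ_const_iff)
    have "L-lipschitz_on {0..} x"
    proof (rule lipschitz_onI[OF _ L])
      fix s t :: real assume "s \<in> {0..}" "t \<in> {0..}"
      then show "dist (x s) (x t) \<le> L * dist s t"
        using lipschitz_onD[OF pX(2)]
        by (intro LIMSEQ_le_const2[OF tendsto_dist[OF Xx Xx]]) auto
    qed
    then show "continuous_on {0..} x" by (rule lipschitz_on_continuous_on)
    fix t :: real assume "t \<ge> 0"
    have dom: "(\<lambda>s. F (x s)) integrable_on {0..t}"
      "(\<lambda>n. integral {0..t} (\<lambda>s. F (p (k n) s))) \<longlonglongrightarrow> integral {0..t} (\<lambda>s. F (x s))"
    proof -
      have 1: "(\<lambda>s. F (p (k n) s)) integrable_on {0..t}" for n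
        using pX(1)[OF \<open>t \<ge> 0\<close>] by (rule has_integral_integrable)
      have 2: "(\<lambda>s. L) integrable_on {0..t}" by (rule integrable_const_ivl)
      have 3: "(\<lambda>n. F (p (k n) s)) \<longlonglongrightarrow> F (x s)" if "s \<in> {0..t}" for s
        using cont px[of s] that by (auto intro: continuous_on_tendsto_compose)
      show "(\<lambda>s. F (x s)) integrable_on {0..t}"
        by (rule dominated_convergence(1)[OF 1 2 bound 3])
      show "(\<lambda>n. integral {0..t} (\<lambda>s. F (p (k n) s))) \<longlonglongrightarrow> integral {0..t} (\<lambda>s. F (x s))"
        by (rule dominated_convergence(2)[OF 1 2 bound 3])
    qed
    moreover have "(\<lambda>n. integral {0..t} (\<lambda>s. F (p (k n) s))) \<longlonglongrightarrow> x t - x0"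
      using integral_unique[OF pX(1)[OF \<open>t \<ge> 0\<close>]] Xx[OF \<open>t \<ge> 0\<close>] by (auto intro: tendsto_intros)
    ultimately have "integral {0..t} (\<lambda>s. F (x s)) = x t - x0"
      by (blast intro: LIMSEQ_unique)
    then show "((\<lambda>s. F (x s)) has_integral x t - x0) {0..t}"
      using dom(1) by (simp add: has_integral_iff)
  qed
qed

text \<open>Continuity is asked on a set \<open>S\<close> so that the lemma covers the closed-loop
  field, which is continuous on \<Omega>.\<close>

lemma integral_equation_imp_has_vector_derivative:
  fixes F :: "'a::euclidean_space \<Rightarrow> 'a"
  assumes cont: "continuous_on {0..} x" and F: "continuous_on S F" and S: "\<And>t. t \<ge> 0 \<Longrightarrow> x t \<in> S"
    and int: "\<And>t. t \<ge> 0 \<Longrightarrow> ((\<lambda>s. F (x s)) has_integral x t - x0) {0..t}" and "t \<ge> 0"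
  shows "(x has_vector_derivative F (x t)) (at t within {0..})"
proof -
  have "continuous_on {0..t+1} (\<lambda>s. F (x s))"
    using S by (intro continuous_on_compose2[OF F] continuous_on_subset[OF cont]) auto
  from integral_has_vector_derivative[OF this, of t] \<open>t \<ge> 0\<close>
  have "((\<lambda>u. x0 + integral {0..u} (\<lambda>s. F (x s))) has_vector_derivative F (x t)) (at t within {0..t+1})"
    by (auto intro!: derivative_eq_intros)
  then have "(x has_vector_derivative F (x t)) (at t within {0..t+1})"
    by (rule has_vector_derivative_transform[rotated 2])
      (use \<open>t \<ge> 0\<close> integral_unique[OF int] in auto)
  moreover have "at t within {0..t+1} = at t within {0..}"
    by (rule at_within_nhd[of _ "{..<t+1}"]) auto
  ultimately show ?thesis by simp
qed

section \<open>Continuously differentiable functions and a Gronwall inequality\<close>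

lemma C1_on_imp_continuous_on: "C1_on f S \<Longrightarrow> continuous_on S f"
  unfolding C1_on_def by (meson continuous_at_imp_continuous_on has_derivative_continuous)

lemma C1_on_imp_lipschitz_on:
  fixes f :: "'a::real_normed_vector \<Rightarrow> 'b::real_normed_vector"
  assumes "C1_on f S" "compact K" "convex K" "K \<subseteq> S"
  obtains L where "L-lipschitz_on K f"
proof -
  obtain f' where f': "\<And>x. x \<in> S \<Longrightarrow> (f has_derivative blinfun_apply (f' x)) (at x)"
    "continuous_on S f'"
    using assms(1) unfolding C1_on_def by blast
  have "bounded (f' ` K)"
    using f'(2) assms(2,4) by (meson compact_continuous_image compact_imp_bounded continuous_on_subset)
  then obtain B where B: "B > 0" "\<And>x. x \<in> K \<Longrightarrow> norm (f' x) \<le> B"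
    by (auto simp: bounded_pos)
  have "B-lipschitz_on K f"
  proof (rule bounded_derivative_imp_lipschitz[OF _ \<open>convex K\<close>])
    show "(f has_derivative blinfun_apply (f' x)) (at x within K)" if "x \<in> K" for x
      using f'(1)[of x] that assms(4) by (meson has_derivative_at_withinI subsetD)
    show "onorm (blinfun_apply (f' x)) \<le> B" if "x \<in> K" for x
      using B(2)[OF that] by (simp add: norm_blinfun.rep_eq)
  qed (use B in simp)
  then show thesis by (rule that)
qed

text \<open>\<open>grad\<close> is a definite description, so both claims rest on an explicit
  gradient: the Riesz vector of the derivative in coordinates, whose formula also shows
  continuity.\<close>

lemma
  fixes v :: "'a::euclidean_space \<Rightarrow> real"
  assumes "C1_on v S"
  shows C1_on_has_derivative_grad: "x \<in> S \<Longrightarrow> (v has_derivative (\<lambda>h. h \<bullet> grad v x)) (at x)"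
    and C1_on_continuous_on_grad: "continuous_on S (grad v)"
proof -
  obtain v' where v': "\<And>x. x \<in> S \<Longrightarrow> (v has_derivative blinfun_apply (v' x)) (at x)"
    "continuous_on S v'"
    using assms(1) unfolding C1_on_def by blast
  have gd: "(v has_derivative (\<lambda>h. h \<bullet> (\<Sum>b\<in>Basis. blinfun_apply (v' x) b *\<^sub>R b))) (at x)" if "x \<in> S" for x
  proof -
    have "blinfun_apply (v' x) = (\<lambda>h. h \<bullet> (\<Sum>b\<in>Basis. blinfun_apply (v' x) b *\<^sub>R b))"
    proof
      fix h
      have "blinfun_apply (v' x) h = blinfun_apply (v' x) (\<Sum>b\<in>Basis. (h \<bullet> b) *\<^sub>R b)"
        by (simp add: euclidean_representation)
      also have "\<dots> = h \<bullet> (\<Sum>b\<in>Basis. blinfun_apply (v' x) b *\<^sub>R b)"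
        by (simp add: blinfun.sum_right blinfun.scaleR_right inner_sum_right mult.commute)
      finally show "blinfun_apply (v' x) h = h \<bullet> (\<Sum>b\<in>Basis. blinfun_apply (v' x) b *\<^sub>R b)" .
    qed
    then show ?thesis using v'(1)[OF that] by simp
  qed
  have grad: "grad v x = (\<Sum>b\<in>Basis. blinfun_apply (v' x) b *\<^sub>R b)" if "x \<in> S" for x
    unfolding grad_def
  proof (rule the_equality)
    show G: "GDERIV v x :> (\<Sum>b\<in>Basis. blinfun_apply (v' x) b *\<^sub>R b)"
      using gd[OF that] by (simp add: gderiv_def)
    fix D assume "GDERIV v x :> D"
    then have "(\<lambda>h. h \<bullet> D) = (\<lambda>h. h \<bullet> (\<Sum>b\<in>Basis. blinfun_apply (v' x) b *\<^sub>R b))"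
      using G unfolding gderiv_def by (rule has_derivative_unique)
    then show "D = (\<Sum>b\<in>Basis. blinfun_apply (v' x) b *\<^sub>R b)"
      by (simp only: fun_eq_iff vector_eq_ldot)
  qed
  show "(v has_derivative (\<lambda>h. h \<bullet> grad v x)) (at x)" if "x \<in> S"
    using gd[OF that] grad[OF that] by simp
  have "continuous_on S (\<lambda>x. \<Sum>b\<in>Basis. blinfun_apply (v' x) b *\<^sub>R b)"
    using v'(2) by (intro continuous_intros)
  then show "continuous_on S (grad v)"
    using grad by (simp cong: continuous_on_cong)
qed

lemma bounded_bilinear_matrix_vector_mult:
  "bounded_bilinear ((*v) :: real ^ 'm ^ 'n \<Rightarrow> real ^ 'm \<Rightarrow> real ^ 'n)"
proof -
  have "linear (\<lambda>A::real ^ 'm ^ 'n. A *v w)" for w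
    by (rule linearI) (simp_all add: matrix_vector_mult_add_rdistrib scaleR_matrix_vector_assoc)
  then have "bilinear ((*v) :: real ^ 'm ^ 'n \<Rightarrow> real ^ 'm \<Rightarrow> real ^ 'n)"
    by (simp add: bilinear_def matrix_vector_mul_linear)
  then show ?thesis by (simp add: bilinear_conv_bounded_bilinear)
qed

lemma norm_matrix_vector_mult_le:
  obtains c where "c > 0" "\<And>(A::real ^ 'm ^ 'n) w. norm (A *v w) \<le> c * norm A * norm w"
proof -
  obtain c where "c > 0" "\<And>(A::real ^ 'm ^ 'n) w. norm (A *v w) \<le> norm A * norm w * c"
    using bounded_bilinear.pos_bounded[OF bounded_bilinear_matrix_vector_mult] by blast
  then show thesis using that[of c] by (simp add: mult_ac)
qed

lemma lipschitz_on_inner: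
  fixes p q :: "'a::metric_space \<Rightarrow> 'b::real_inner"
  assumes p: "A-lipschitz_on S p" and q: "B-lipschitz_on S q"
    and bound: "\<And>t. t \<in> S \<Longrightarrow> norm (p t) \<le> P" "\<And>t. t \<in> S \<Longrightarrow> norm (q t) \<le> Q" "P \<ge> 0" "Q \<ge> 0"
  shows "(A * Q + P * B)-lipschitz_on S (\<lambda>t. p t \<bullet> q t)"
proof (rule lipschitz_onI)
  have AB: "A \<ge> 0" "B \<ge> 0" using p q lipschitz_on_nonneg by auto
  then show "A * Q + P * B \<ge> 0" using bound(3,4) by simp
  fix s t assume st: "s \<in> S" "t \<in> S"
  have "dist (p s \<bullet> q s) (p t \<bullet> q t) = \<bar>(p s - p t) \<bullet> q s + p t \<bullet> (q s - q t)\<bar>"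
    by (simp add: dist_real_def inner_diff_left inner_diff_right)
  also have "\<dots> \<le> norm (p s - p t) * norm (q s) + norm (p t) * norm (q s - q t)"
    using Cauchy_Schwarz_ineq2[of "p s - p t" "q s"] Cauchy_Schwarz_ineq2[of "p t" "q s - q t"] by linarith
  also have "\<dots> \<le> (A * dist s t) * Q + P * (B * dist s t)"
    using lipschitz_onD[OF p st] lipschitz_onD[OF q st] bound st AB
    by (intro add_mono mult_mono) (auto simp: dist_norm)
  finally show "dist (p s \<bullet> q s) (p t \<bullet> q t) \<le> (A * Q + P * B) * dist s t"
    by (simp add: algebra_simps)
qed

text \<open>Integrating factor: \<open>exp (- K * t) * z t\<close> has derivative at most 0 off
  \<open>E\<close>. The Lipschitz hypothesis makes this product absolutely continuous, so the almost
  everywhere inequality may be integrated; the sign of \<open>z b\<close> then forces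
  equality.\<close>

lemma gronwall_eq_0:
  fixes z :: "real \<Rightarrow> real"
  assumes "b \<ge> 0" and lip: "C-lipschitz_on {0..b} z" and "z 0 = 0" and nn: "z b \<ge> 0"
    and "negligible E"
    and der: "\<And>t. t \<in> {0..b} - E \<Longrightarrow> (z has_vector_derivative z' t) (at t within {0..b})"
    and le: "\<And>t. t \<in> {0..b} - E \<Longrightarrow> z' t \<le> K * z t"
  shows "z b = 0"
proof -
  have der_exp: "((\<lambda>t. exp (- K * t)) has_vector_derivative - K * exp (- K * t)) (at t within S)" for t S
    by (auto intro!: derivative_eq_intros simp: has_real_derivative_iff_has_vector_derivative[symmetric])
  have bdd: "\<exists>B>0. \<forall>t\<in>{0..b}. norm (p t) \<le> B" if "continuous_on {0..b} p" for p :: "real \<Rightarrow> real"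
    using compact_imp_bounded[OF compact_continuous_image[OF that compact_Icc]] by (auto simp: bounded_pos)
  have "continuous_on {0..b} (\<lambda>t. - K * exp (- K * t))" by (intro continuous_intros)
  from bdd[OF this] obtain D where D: "D > 0" "\<And>t. t \<in> {0..b} \<Longrightarrow> norm (- K * exp (- K * t)) \<le> D" by blast
  have "D-lipschitz_on {0..b} (\<lambda>t. exp (- K * t))"
  proof (rule bounded_derivative_imp_lipschitz)
    show "((\<lambda>t. exp (- K * t)) has_derivative (\<lambda>h. h *\<^sub>R (- K * exp (- K * t)))) (at t within {0..b})" for t
      using der_exp unfolding has_vector_derivative_def .
    show "onorm (\<lambda>h. h *\<^sub>R (- K * exp (- K * t))) \<le> D" if "t \<in> {0..b}" for t
    proof (rule onorm_le)
      fix h :: real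
      show "norm (h *\<^sub>R (- K * exp (- K * t))) \<le> D * norm h"
        using mult_right_mono[OF D(2)[OF that], of "norm h"] by (simp add: mult_ac abs_mult)
    qed
  qed (use D in auto)
  moreover have "continuous_on {0..b} (\<lambda>t. exp (- K * t))" by (intro continuous_intros)
  from bdd[OF this] obtain P where P: "P > 0" "\<And>t. t \<in> {0..b} \<Longrightarrow> norm (exp (- K * t)) \<le> P" by blast
  from bdd[OF lipschitz_on_continuous_on[OF lip]]
  obtain Q where Q: "Q > 0" "\<And>t. t \<in> {0..b} \<Longrightarrow> norm (z t) \<le> Q" by blast
  ultimately have "(D * Q + P * C)-lipschitz_on {0..b} (\<lambda>t. exp (- K * t) \<bullet> z t)"
    using lip P Q by (intro lipschitz_on_inner) auto
  then have "abs_cont_on 0 b (\<lambda>t. exp (- K * t) * z t)"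
    using lipschitz_on_imp_abs_cont_on by fastforce
  from has_integral_abs_cont_on[OF \<open>b \<ge> 0\<close> this \<open>negligible E\<close>,
      of "\<lambda>t. exp (- K * t) * z' t + (- K * exp (- K * t)) * z t"]
  have int: "((\<lambda>t. exp (- K * t) * z' t + (- K * exp (- K * t)) * z t) has_integral exp (- K * b) * z b - 0) {0..b}"
    using \<open>z 0 = 0\<close> has_vector_derivative_mult[OF der_exp der] by simp
  have "exp (- K * b) * z b - 0 \<le> 0"
  proof (rule has_integral_le)
    \<comment> \<open>The differential inequality says nothing on \<open>E\<close>, so the integrand
      is set to 0 there before comparing pointwise.\<close>
    show "((\<lambda>t. if t \<in> E then 0 else exp (- K * t) * z' t + (- K * exp (- K * t)) * z t)
        has_integral exp (- K * b) * z b - 0) {0..b}"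
      by (rule has_integral_spike[OF \<open>negligible E\<close> _ int]) auto
    show "((\<lambda>t. 0) has_integral 0) {0..b}" by simp
    fix t assume t: "t \<in> {0..b}"
    have "exp (- K * t) * (z' t - K * z t) \<le> 0" if "t \<notin> E"
      using le[of t] t that by (simp add: mult_le_0_iff)
    then show "(if t \<in> E then 0 else exp (- K * t) * z' t + (- K * exp (- K * t)) * z t) \<le> 0"
      by (simp add: algebra_simps)
  qed
  then show ?thesis using nn by (simp add: mult_le_0_iff)
qed

section \<open>Solutions in the sense of Caratheodory\<close>

lemma time_interval_infinity [simp]: "time_interval \<infinity> = {0..}"
  by (auto simp: time_interval_def)

lemma AE_lebesgue_negligible:
  assumes "AE t in lebesgue. P t"
  obtains E where "negligible E" "\<And>t. t \<notin> E \<Longrightarrow> P t"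
  using AE_E3[OF assms] by (auto simp: negligible_iff_null_sets)

lemma U_inf_bound:
  assumes "u \<in> U_inf"
  obtains E c where "negligible E" "c \<ge> 0" "\<And>t. 0 \<le> t \<Longrightarrow> t \<notin> E \<Longrightarrow> norm (u t) \<le> c"
proof -
  obtain c where "AE t in lebesgue_on {0..}. norm (u t) \<le> c"
    using assms by (auto simp: U_inf_def)
  then have "AE t in lebesgue. t \<in> {0..} \<longrightarrow> norm (u t) \<le> c"
    by (subst (asm) AE_restrict_space_iff) auto
  then obtain E where "negligible E" "\<And>t. t \<notin> E \<Longrightarrow> t \<in> {0..} \<longrightarrow> norm (u t) \<le> c"
    by (rule AE_lebesgue_negligible) blast
  then show thesis by (intro that[of E "max c 0"]) (auto simp: le_max_iff_disj)
qed

lemma caratheodory_solution_derivative: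
  assumes "caratheodory_solution f g u x0 \<infinity> x"
  obtains E where "negligible E"
    "\<And>t. 0 \<le> t \<Longrightarrow> t \<notin> E \<Longrightarrow> (x has_vector_derivative f (x t) + g (x t) *v u t) (at t)"
proof -
  have "AE t in lebesgue. 0 \<le> t \<longrightarrow> (x has_vector_derivative f (x t) + g (x t) *v u t) (at t)"
    using assms by (simp add: caratheodory_solution_def)
  then show thesis by (rule AE_lebesgue_negligible) (use that in blast)
qed

lemma caratheodory_solution_continuous_on:
  assumes "caratheodory_solution f g u x0 \<infinity> x"
  shows "continuous_on {0..b} x"
  using assms abs_cont_on_imp_continuous_on[of 0 b x]
  by (cases "0 \<le> b") (auto simp: caratheodory_solution_def)

lemma caratheodory_solution_has_integral:
  assumes sol: "caratheodory_solution f g u x0 \<infinity> x" and "0 \<le> s" "s \<le> t"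
  shows "((\<lambda>r. f (x r) + g (x r) *v u r) has_integral x t - x s) {s..t}"
proof -
  obtain E where E: "negligible E"
    "\<And>t. 0 \<le> t \<Longrightarrow> t \<notin> E \<Longrightarrow> (x has_vector_derivative f (x t) + g (x t) *v u t) (at t)"
    using caratheodory_solution_derivative[OF sol] by metis
  have "abs_cont_on 0 t x" using sol \<open>0 \<le> s\<close> \<open>s \<le> t\<close> by (simp add: caratheodory_solution_def)
  then have "abs_cont_on s t x" using \<open>0 \<le> s\<close> by (rule abs_cont_on_subinterval) simp
  then show ?thesis
    using \<open>0 \<le> s\<close> by (intro has_integral_abs_cont_on[OF \<open>s \<le> t\<close> _ E(1)] has_vector_derivative_at_within[OF E(2)]) auto
qed

text \<open>An essentially bounded control gives an essentially bounded velocity on compact time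
  intervals. Lipschitz continuity, unlike absolute continuity, is stable under composition, which is
  needed for \<open>v\<close> along a trajectory.\<close>

lemma caratheodory_solution_lipschitz_on:
  fixes f :: "real ^ 'n \<Rightarrow> real ^ 'n" and g :: "real ^ 'n \<Rightarrow> real ^ 'm ^ 'n"
  assumes sol: "caratheodory_solution f g u x0 \<infinity> x" and "u \<in> U_inf"
    and cont: "continuous_on UNIV f" "continuous_on UNIV g"
  obtains L where "L-lipschitz_on {0..b} x"
proof -
  obtain E c where E: "negligible E" "c \<ge> 0" "\<And>t. 0 \<le> t \<Longrightarrow> t \<notin> E \<Longrightarrow> norm (u t) \<le> c"
    using U_inf_bound[OF \<open>u \<in> U_inf\<close>] by metis
  have bdd: "\<exists>B>0. \<forall>t\<in>{0..b}. norm (p (x t)) \<le> B" if "continuous_on UNIV p"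
    for p :: "real ^ 'n \<Rightarrow> 'b::real_normed_vector"
  proof -
    have "continuous_on {0..b} (\<lambda>t. p (x t))"
      using caratheodory_solution_continuous_on[OF sol] that by (blast intro: continuous_on_compose2)
    from compact_imp_bounded[OF compact_continuous_image[OF this compact_Icc]]
    show ?thesis by (auto simp: bounded_pos)
  qed
  obtain A where A: "A > 0" "\<And>t. t \<in> {0..b} \<Longrightarrow> norm (f (x t)) \<le> A" using bdd[OF cont(1)] by blast
  obtain B where B: "B > 0" "\<And>t. t \<in> {0..b} \<Longrightarrow> norm (g (x t)) \<le> B" using bdd[OF cont(2)] by blast
  obtain k where k: "k > 0" "\<And>(M::real ^ 'm ^ 'n) w. norm (M *v w) \<le> k * norm M * norm w"
    using norm_matrix_vector_mult_le by blast
  let ?L = "A + k * B * c"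
  have L: "?L \<ge> 0" using A(1) B(1) k(1) E(2) by simp
  have step: "norm (x t - x s) \<le> ?L * (t - s)" if st: "0 \<le> s" "s \<le> t" "t \<le> b" for s t
  proof -
    let ?F = "\<lambda>r. f (x r) + g (x r) *v u r"
    have "((\<lambda>r. if r \<in> E then 0 else ?F r) has_integral x t - x s) (cbox s t)"
      using has_integral_spike[OF E(1) _ caratheodory_solution_has_integral[OF sol st(1,2)],
          of "\<lambda>r. if r \<in> E then 0 else ?F r"] by simp
    then have "norm (x t - x s) \<le> ?L * measure lborel (cbox s t)"
    proof (rule has_integral_bound[OF L])
      fix r assume r: "r \<in> cbox s t"
      have "norm (?F r) \<le> ?L" if "r \<notin> E"
      proof -
        have "norm (g (x r) *v u r) \<le> k * norm (g (x r)) * norm (u r)" by (rule k(2))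
        also have "\<dots> \<le> k * B * c"
          using B(2)[of r] E(3)[of r] r st that k(1) B(1) by (intro mult_mono) auto
        finally show ?thesis
          using A(2)[of r] r st norm_triangle_ineq[of "f (x r)" "g (x r) *v u r"] by auto
      qed
      then show "norm (if r \<in> E then 0 else ?F r) \<le> ?L" using L by simp
    qed
    then show ?thesis using st by simp
  qed
  have "?L-lipschitz_on {0..b} x"
  proof (rule lipschitz_onI[OF _ L])
    fix s t assume "s \<in> {0..b}" "t \<in> {0..b}"
    then show "dist (x s) (x t) \<le> ?L * dist s t"
      using step[of s t] step[of t s] by (cases "s \<le> t") (auto simp: dist_norm norm_minus_commute)
  qed
  then show thesis by (rule that)
qed

text \<open>Gronwall for the squared distance, with Lipschitz constants of \<open>f\<close> and
  \<open>g\<close> on a ball that contains both trajectories up to \<open>b\<close>.\<close>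

lemma caratheodory_solution_unique:
  fixes f :: "real ^ 'n \<Rightarrow> real ^ 'n" and g :: "real ^ 'n \<Rightarrow> real ^ 'm ^ 'n"
  assumes x: "caratheodory_solution f g u x0 \<infinity> x" and y: "caratheodory_solution f g u x0 \<infinity> y"
    and "u \<in> U_inf" and C1: "C1_on f UNIV" "C1_on g UNIV" and "b \<ge> 0"
  shows "x b = y b"
proof -
  note cont = C1[THEN C1_on_imp_continuous_on]
  obtain Lx where Lx: "Lx-lipschitz_on {0..b} x"
    using caratheodory_solution_lipschitz_on[OF x \<open>u \<in> U_inf\<close> cont] by metis
  obtain Ly where Ly: "Ly-lipschitz_on {0..b} y"
    using caratheodory_solution_lipschitz_on[OF y \<open>u \<in> U_inf\<close> cont] by metis
  have "bounded (x ` {0..b} \<union> y ` {0..b})"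
    using Lx Ly by (auto intro!: compact_imp_bounded compact_continuous_image lipschitz_on_continuous_on)
  then obtain r where "r > 0" and r: "\<And>t. t \<in> {0..b} \<Longrightarrow> x t \<in> cball 0 r" "\<And>t. t \<in> {0..b} \<Longrightarrow> y t \<in> cball 0 r"
    by (auto simp: bounded_pos)
  obtain Lf where Lf: "Lf-lipschitz_on (cball 0 r) f"
    using C1_on_imp_lipschitz_on[OF C1(1) compact_cball convex_cball subset_UNIV] .
  obtain Lg where Lg: "Lg-lipschitz_on (cball 0 r) g"
    using C1_on_imp_lipschitz_on[OF C1(2) compact_cball convex_cball subset_UNIV] .
  have nn: "Lf \<ge> 0" "Lg \<ge> 0" using Lf Lg lipschitz_on_nonneg by auto
  obtain k where k: "k > 0" "\<And>(M::real ^ 'm ^ 'n) w. norm (M *v w) \<le> k * norm M * norm w"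
    using norm_matrix_vector_mult_le by blast
  obtain E0 c where E0: "negligible E0" "c \<ge> 0" "\<And>t. 0 \<le> t \<Longrightarrow> t \<notin> E0 \<Longrightarrow> norm (u t) \<le> c"
    using U_inf_bound[OF \<open>u \<in> U_inf\<close>] by metis
  obtain E1 where E1: "negligible E1"
    "\<And>t. 0 \<le> t \<Longrightarrow> t \<notin> E1 \<Longrightarrow> (x has_vector_derivative f (x t) + g (x t) *v u t) (at t)"
    using caratheodory_solution_derivative[OF x] by metis
  obtain E2 where E2: "negligible E2"
    "\<And>t. 0 \<le> t \<Longrightarrow> t \<notin> E2 \<Longrightarrow> (y has_vector_derivative f (y t) + g (y t) *v u t) (at t)"
    using caratheodory_solution_derivative[OF y] by metis
  let ?d = "\<lambda>t. x t - y t"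
  let ?d' = "\<lambda>t. f (x t) + g (x t) *v u t - (f (y t) + g (y t) *v u t)"
  let ?K = "Lf + k * Lg * c"
  have d: "(Lx + Ly)-lipschitz_on {0..b} ?d" using Lx Ly by (rule lipschitz_on_diff)
  have db: "norm (?d t) \<le> 2 * r" if "t \<in> {0..b}" for t
    using r[OF that] norm_triangle_ineq4[of "x t" "y t"] by simp
  have lip: "((Lx + Ly) * (2 * r) + (2 * r) * (Lx + Ly))-lipschitz_on {0..b} (\<lambda>t. ?d t \<bullet> ?d t)"
    using d db \<open>r > 0\<close> by (intro lipschitz_on_inner) auto
  have "?d b \<bullet> ?d b = 0"
  proof (rule gronwall_eq_0[OF \<open>b \<ge> 0\<close> lip])
    show "negligible (E0 \<union> E1 \<union> E2)" using E0(1) E1(1) E2(1) by simp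
    show "?d 0 \<bullet> ?d 0 = 0" using x y by (simp add: caratheodory_solution_def)
    fix t assume t: "t \<in> {0..b} - (E0 \<union> E1 \<union> E2)"
    have "(?d has_vector_derivative ?d' t) (at t within {0..b})"
      using has_vector_derivative_diff[OF E1(2)[of t] E2(2)[of t]] t
      by (auto intro: has_vector_derivative_at_within)
    from bounded_bilinear.has_vector_derivative[OF bounded_bilinear_inner this this]
    show "((\<lambda>t. ?d t \<bullet> ?d t) has_vector_derivative 2 * (?d t \<bullet> ?d' t)) (at t within {0..b})"
      by (simp add: inner_commute)
    have "?d' t = (f (x t) - f (y t)) + (g (x t) - g (y t)) *v u t"
      by (simp add: matrix_vector_mult_diff_rdistrib)
    also have "norm \<dots> \<le> norm (f (x t) - f (y t)) + norm ((g (x t) - g (y t)) *v u t)"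
      by (rule norm_triangle_ineq)
    also have "\<dots> \<le> Lf * norm (?d t) + k * (Lg * norm (?d t)) * c"
    proof (rule add_mono)
      show "norm (f (x t) - f (y t)) \<le> Lf * norm (?d t)"
        using lipschitz_onD[OF Lf r(1) r(2), of t t] t by (simp add: dist_norm)
      have "norm (g (x t) - g (y t)) \<le> Lg * norm (?d t)"
        using lipschitz_onD[OF Lg r(1) r(2), of t t] t by (simp add: dist_norm)
      then show "norm ((g (x t) - g (y t)) *v u t) \<le> k * (Lg * norm (?d t)) * c"
        using t E0(3)[of t] k(1) nn by (intro order_trans[OF k(2)] mult_mono) auto
    qed
    also have "\<dots> = ?K * norm (?d t)" by (simp add: algebra_simps)
    finally have "norm (?d t) * norm (?d' t) \<le> norm (?d t) * (?K * norm (?d t))"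
      by (simp add: mult_left_mono)
    then have "?d t \<bullet> ?d' t \<le> ?K * (norm (?d t))\<^sup>2"
      using norm_cauchy_schwarz[of "?d t" "?d' t"] by (simp add: power2_eq_square mult_ac)
    then show "2 * (?d t \<bullet> ?d' t) \<le> (2 * ?K) * (?d t \<bullet> ?d t)"
      unfolding mult.assoc power2_norm_eq_inner by (rule mult_left_mono) simp
  qed simp
  then show ?thesis by simp
qed

section \<open>Quadratic forms, hitting times and the running cost\<close>

lemma sym_pos_def_inner_commute:
  "sym_pos_def R \<Longrightarrow> y \<bullet> (R *v w) = w \<bullet> (R *v y)"
  by (metis dot_lmul_matrix inner_commute sym_pos_def_def transpose_matrix_vector)

lemma sym_pos_def_nonneg: "sym_pos_def R \<Longrightarrow> y \<bullet> (R *v y) \<ge> 0"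
  unfolding sym_pos_def_def by (cases "y = 0") (auto intro: less_imp_le)

lemma sym_pos_def_matrix_inv:
  fixes R :: "real ^ 'm ^ 'm"
  assumes "sym_pos_def R"
  shows "R *v (matrix_inv R *v y) = y"
proof -
  have "\<forall>x. R *v x = 0 \<longrightarrow> x = 0"
  proof (intro allI impI)
    fix x assume "R *v x = 0"
    then have "x \<bullet> (R *v x) = 0" by simp
    then show "x = 0" using assms unfolding sym_pos_def_def by (metis less_irrefl)
  qed
  then have "invertible R" using matrix_left_invertible_ker invertible_left_inverse by blast
  then have "\<exists>B. R ** B = mat 1 \<and> B ** R = mat 1" by (simp add: invertible_def)
  then have "R ** matrix_inv R = mat 1" unfolding matrix_inv_def by (rule someI2_ex) simp
  then show ?thesis by (simp add: matrix_vector_mul_assoc)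
qed

text \<open>The constant is the minimum of the quadratic form on the unit sphere, that is, the
  smallest eigenvalue of \<open>R\<close>; homogeneity does the rest.\<close>

lemma sym_pos_def_coercive:
  fixes R :: "real ^ 'm ^ 'm"
  assumes "sym_pos_def R"
  obtains c where "c > 0" "\<And>w. c * (norm w)\<^sup>2 \<le> w \<bullet> (R *v w)"
proof -
  have "continuous_on (sphere 0 1) (\<lambda>w. w \<bullet> (R *v w))" by (intro continuous_intros)
  moreover have "sphere (0::real ^ 'm) 1 \<noteq> {}" by simp
  ultimately obtain w0 where w0: "w0 \<in> sphere 0 1" "\<And>w. w \<in> sphere 0 1 \<Longrightarrow> w0 \<bullet> (R *v w0) \<le> w \<bullet> (R *v w)"
    using continuous_attains_inf[OF compact_sphere] by blast
  have "w0 \<noteq> 0" using w0(1) by auto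
  then have "w0 \<bullet> (R *v w0) > 0" using assms by (simp add: sym_pos_def_def)
  moreover have "w0 \<bullet> (R *v w0) * (norm w)\<^sup>2 \<le> w \<bullet> (R *v w)" for w
  proof (cases "w = 0")
    case False
    define z where "z = w /\<^sub>R norm w"
    have w: "w = norm w *\<^sub>R z" using False by (simp add: z_def)
    have "z \<in> sphere 0 1" using False by (simp add: z_def)
    then have "w0 \<bullet> (R *v w0) * (norm w)\<^sup>2 \<le> (z \<bullet> (R *v z)) * (norm w)\<^sup>2"
      using w0(2) by (intro mult_right_mono) auto
    also have "\<dots> = (norm w *\<^sub>R z) \<bullet> (R *v (norm w *\<^sub>R z))"
      by (simp add: matrix_vector_mult_scaleR power2_eq_square)
    finally show ?thesis using w by metis
  qed simp
  ultimately show thesis by (rule that)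
qed

section \<open>First hitting and crossing times of a continuous real function\<close>

lemma first_hitting_time:
  fixes p :: "real \<Rightarrow> real"
  assumes cont: "continuous_on {a..b} p" and "a \<le> b" "p a < c" "c \<le> p b"
  obtains s where "a < s" "s \<le> b" "p s = c" "\<And>r. a \<le> r \<Longrightarrow> r < s \<Longrightarrow> p r < c"
proof -
  define H where "H = {s \<in> {a..b}. p s = c}"
  have "closed H" unfolding H_def
    by (rule continuous_closed_preimage_constant[OF cont closed_atLeastAtMost])
  moreover have "\<exists>s. a \<le> s \<and> s \<le> b \<and> p s = c"
    using cont assms by (intro IVT') auto
  then have "H \<noteq> {}" by (auto simp: H_def)
  moreover have bdd: "bdd_below H" by (rule bdd_belowI[of _ a]) (simp add: H_def)
  ultimately have "Inf H \<in> H" by (intro closed_contains_Inf)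
  then have s: "a \<le> Inf H" "Inf H \<le> b" "p (Inf H) = c" by (auto simp: H_def)
  have "p r < c" if r: "a \<le> r" "r < Inf H" for r
  proof (rule ccontr)
    assume "\<not> p r < c"
    moreover have "continuous_on {a..r} p" using cont by (rule continuous_on_subset) (use r s in auto)
    ultimately have "\<exists>s'. a \<le> s' \<and> s' \<le> r \<and> p s' = c" using assms r by (intro IVT') auto
    then obtain s' where "s' \<in> H" "s' \<le> r" using r s by (auto simp: H_def)
    then show False using cInf_lower[OF _ bdd] r by fastforce
  qed
  moreover have "a \<noteq> Inf H" using s(3) assms(3) by auto
  ultimately show thesis using s by (intro that[of "Inf H"]) auto
qed

text \<open>Take the first visit to \<open>d\<close> and then the last visit to \<open>c\<close>
  before it: in between neither level is passed.\<close>

lemma crossing_interval: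
  fixes p :: "real \<Rightarrow> real"
  assumes cont: "continuous_on {a..b} p" and "a \<le> b" "p a < c" "c < d" "d \<le> p b"
  obtains s t where "a \<le> s" "s \<le> t" "t \<le> b" "p s = c" "p t = d" "\<And>r. r \<in> {s..t} \<Longrightarrow> c \<le> p r \<and> p r \<le> d"
proof -
  have "p a < d" using assms(3,4) by simp
  from first_hitting_time[OF cont \<open>a \<le> b\<close> this \<open>d \<le> p b\<close>]
  obtain t where t: "a < t" "t \<le> b" "p t = d" "\<And>r. a \<le> r \<Longrightarrow> r < t \<Longrightarrow> p r < d"
    by blast
  \<comment> \<open>Time reversal: the first time at which \<open>- p (- r)\<close> reaches
    \<open>- c\<close> is the negative of the last time before \<open>t\<close> at which
    \<open>p\<close> equals \<open>c\<close>.\<close>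
  have "continuous_on {-t..-a} (\<lambda>r. - p (- r))"
    by (intro continuous_intros continuous_on_compose2[OF cont]) (use t in auto)
  moreover have "- t \<le> - a" "- p (- (- t)) < - c" "- c \<le> - p (- (- a))"
    using t assms by simp_all
  ultimately obtain s where
    s: "- t < s" "s \<le> - a" "- p (- s) = - c" "\<And>r. - t \<le> r \<Longrightarrow> r < s \<Longrightarrow> - p (- r) < - c"
    by (rule first_hitting_time) blast
  show thesis
  proof (rule that[of "- s" t])
    fix r assume r: "r \<in> {- s..t}"
    show "c \<le> p r \<and> p r \<le> d"
    proof
      show "c \<le> p r" using s(3) s(4)[of "- r"] r by (cases "r = - s") auto
      show "p r \<le> d" using t(3) t(4)[of r] r s by (cases "r = t") auto
    qed
  qed (use s t in auto)
qed

section \<open>The running cost along a trajectory\<close>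

lemma continuous_on_atLeast:
  fixes x :: "real \<Rightarrow> 'a::topological_space"
  assumes "\<And>b. continuous_on {0..b} x"
  shows "continuous_on {0..} x"
  unfolding continuous_on_eq_continuous_within
proof
  fix t :: real assume "t \<in> {0..}"
  then have "continuous (at t within {0..t+1}) x"
    using assms[of "t + 1"] by (auto simp: continuous_on_eq_continuous_within)
  moreover have "at t within {0..t+1} = at t within {0..}"
    by (rule at_within_nhd[of _ "{..<t+1}"]) auto
  ultimately show "continuous (at t within {0..}) x" by simp
qed

definition running_cost :: "(real ^ 'n \<Rightarrow> real) \<Rightarrow> real ^ 'm ^ 'm \<Rightarrow> real ^ 'n \<Rightarrow> real ^ 'm \<Rightarrow> real" where
  "running_cost h R y w = h y + w \<bullet> (R *v w)"

lemma running_cost_measurable: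
  fixes h :: "real ^ 'n \<Rightarrow> real" and R :: "real ^ 'm ^ 'm" and x :: "real \<Rightarrow> real ^ 'n"
  assumes x: "continuous_on {0..} x" and h: "continuous_on UNIV h" and "u \<in> borel_measurable (lebesgue_on {0..})"
  shows "(\<lambda>t. running_cost h R (x t) (u t)) \<in> borel_measurable (lebesgue_on {0..})"
proof -
  have "(\<lambda>t. h (x t)) \<in> borel_measurable (lebesgue_on {0..})"
    using continuous_on_compose2[OF h x]
    by (intro continuous_imp_measurable_on_sets_lebesgue) auto
  moreover have "(\<lambda>w. w \<bullet> (R *v w)) \<in> borel_measurable borel"
    by (intro borel_measurable_continuous_onI continuous_intros)
  then have "(\<lambda>t. u t \<bullet> (R *v u t)) \<in> borel_measurable (lebesgue_on {0..})"
    using assms(3) by (rule measurable_compose_rev)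
  ultimately show ?thesis unfolding running_cost_def by (rule borel_measurable_add)
qed

text \<open>Costs are extended nonnegative Lebesgue integrals, whereas the fundamental theorem above
  yields Henstock-Kurzweil integrals; finiteness of the cost permits the passage.\<close>

lemma nn_integral_atLeast_finite:
  fixes \<phi> :: "real \<Rightarrow> real"
  assumes meas: "\<phi> \<in> borel_measurable (lebesgue_on {0..})" and nn: "\<And>t. \<phi> t \<ge> 0"
    and I: "(\<integral>\<^sup>+t\<in>{0..}. ennreal (\<phi> t) \<partial>lebesgue) = ennreal I" "I \<ge> 0"
  assumes "0 \<le> a"
  shows "\<phi> integrable_on {a..b}" "integral {a..b} \<phi> \<le> I"
proof -
  have "(\<lambda>t. if t \<in> {0..} then \<phi> t else 0) \<in> borel_measurable lebesgue"
    using borel_measurable_if_I[OF meas] by simp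
  moreover have "(\<integral>\<^sup>+t. ennreal (if t \<in> {0..} then \<phi> t else 0) \<partial>lebesgue) = ennreal I"
    unfolding I(1)[symmetric] by (intro nn_integral_cong) (auto simp: indicator_def)
  ultimately have "((\<lambda>t. if t \<in> {0..} then \<phi> t else 0) has_integral I) UNIV"
    using nn I(2) by (subst has_integral_iff_nn_integral_lebesgue) auto
  then have int: "(\<phi> has_integral I) {0..}"
    by (simp only: has_integral_restrict_UNIV)
  then show ab: "\<phi> integrable_on {a..b}"
    by (rule integrable_on_subinterval[OF has_integral_integrable]) (use \<open>0 \<le> a\<close> in auto)
  show "integral {a..b} \<phi> \<le> I"
    using integral_subset_le[OF _ ab has_integral_integrable[OF int]] nn \<open>0 \<le> a\<close> integral_unique[OF int]
    by auto
qed

section \<open>Lower bound for the cost\<close>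

locale hjb_solution =
  fixes f :: "real ^ 'n \<Rightarrow> real ^ 'n"
    and g :: "real ^ 'n \<Rightarrow> real ^ 'm ^ 'n"
    and h :: "real ^ 'n \<Rightarrow> real"
    and R :: "real ^ 'm ^ 'm"
    and \<Omega> :: "(real ^ 'n) set"
    and v :: "real ^ 'n \<Rightarrow> real"
  assumes C1_f: "C1_on f UNIV" and C1_g: "C1_on g UNIV" and cont_h: "continuous_on UNIV h"
    and R: "sym_pos_def R"
    and h_0: "h 0 = 0" and h_pos: "\<And>x. x \<noteq> 0 \<Longrightarrow> h x > 0"
    and open_\<Omega>: "open \<Omega>" and zero_in_\<Omega>: "0 \<in> \<Omega>"
    and C1_v: "C1_on v \<Omega>" and v_nonneg: "\<And>x. x \<in> \<Omega> \<Longrightarrow> v x \<ge> 0" and v_0: "v 0 = 0"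
    and hjb: "\<And>x. x \<in> \<Omega> \<Longrightarrow>
           (f x + g x *v hjb_feedback g R v x) \<bullet> grad v x + h x
             + (weighted_norm R (hjb_feedback g R v x))\<^sup>2 = 0"
begin

section \<open>Bellman identity and regularity of the feedback\<close>

abbreviation \<mu> :: "real ^ 'n \<Rightarrow> real ^ 'm" where "\<mu> \<equiv> hjb_feedback g R v"

abbreviation \<kappa> :: "real ^ 'n \<Rightarrow> real ^ 'm \<Rightarrow> real" where "\<kappa> \<equiv> running_cost h R"

lemmas cont_f = C1_on_imp_continuous_on[OF C1_f]
  and cont_g = C1_on_imp_continuous_on[OF C1_g]
  and cont_v = C1_on_imp_continuous_on[OF C1_v]

lemma h_nonneg: "h x \<ge> 0"
  using h_0 h_pos[of x] by (cases "x = 0") auto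

lemma cost_nonneg: "\<kappa> x w \<ge> 0" and h_le_cost: "h x \<le> \<kappa> x w"
  using h_nonneg[of x] sym_pos_def_nonneg[OF R, of w] by (auto simp: running_cost_def)

lemma bellman_identity:
  assumes "x \<in> \<Omega>"
  shows "(f x + g x *v w) \<bullet> grad v x + \<kappa> x w = (w - \<mu> x) \<bullet> (R *v (w - \<mu> x))"
proof -
  have adj: "(g x *v y) \<bullet> grad v x = - 2 * (y \<bullet> (R *v \<mu> x))" for y
  proof -
    have "(g x *v y) \<bullet> grad v x = y \<bullet> (transpose (g x) *v grad v x)"
      by (metis dot_lmul_matrix inner_commute transpose_matrix_vector)
    also have "transpose (g x) *v grad v x = - 2 *\<^sub>R (R *v \<mu> x)"
      unfolding hjb_feedback_def matrix_vector_mult_scaleR sym_pos_def_matrix_inv[OF R] by simp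
    finally show ?thesis by simp
  qed
  have "weighted_norm R (\<mu> x) ^ 2 = \<mu> x \<bullet> (R *v \<mu> x)"
    using sym_pos_def_nonneg[OF R] by (simp add: weighted_norm_def)
  \<comment> \<open>By \<open>adj\<close> the control term of the identity is minus twice the
    quadratic form at \<open>\<mu> x\<close>, so one copy remains on the right. It is the constant
    term of the square in \<open>w - \<mu> x\<close>, and \<open>adj\<close> for \<open>w\<close>
    gives the mixed term.\<close>
  then have "f x \<bullet> grad v x + h x = \<mu> x \<bullet> (R *v \<mu> x)"
    using hjb[OF assms] adj[of "\<mu> x"] by (simp add: inner_add_left)
  then show ?thesis
    using adj[of w] sym_pos_def_inner_commute[OF R, of "\<mu> x" w]
    by (simp add: running_cost_def inner_add_left inner_diff_left inner_diff_right
        matrix_vector_mult_diff_distrib)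
qed

lemma bellman_inequality: "x \<in> \<Omega> \<Longrightarrow> (f x + g x *v w) \<bullet> grad v x \<ge> - \<kappa> x w"
  using bellman_identity[of x w] sym_pos_def_nonneg[OF R, of "w - \<mu> x"] by linarith

lemma bellman_equality: "x \<in> \<Omega> \<Longrightarrow> (f x + g x *v \<mu> x) \<bullet> grad v x = - \<kappa> x (\<mu> x)"
  using bellman_identity[of x "\<mu> x"] by simp

lemma continuous_on_\<mu>: "continuous_on \<Omega> \<mu>"
proof -
  have "linear (\<lambda>A::real ^ 'm ^ 'n. transpose A)"
    by (rule linearI) (simp_all add: transpose_def vec_eq_iff)
  then have "continuous_on UNIV (\<lambda>A::real ^ 'm ^ 'n. transpose A)"
    by (intro linear_continuous_on) (simp add: linear_conv_bounded_linear)
  then have "continuous_on \<Omega> (\<lambda>x. transpose (g x))"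
    using continuous_on_subset[OF cont_g subset_UNIV] by (rule continuous_on_compose2) simp
  then have "continuous_on \<Omega> (\<lambda>x. transpose (g x) *v grad v x)"
    using C1_on_continuous_on_grad[OF C1_v]
    by (rule bounded_bilinear.continuous_on[OF bounded_bilinear_matrix_vector_mult])
  then have "continuous_on \<Omega> (\<lambda>x. matrix_inv R *v (transpose (g x) *v grad v x))"
    by (rule bounded_bilinear.continuous_on[OF bounded_bilinear_matrix_vector_mult continuous_on_const])
  then show ?thesis unfolding hjb_feedback_def by (intro continuous_intros)
qed

lemma continuous_on_closed_loop: "continuous_on \<Omega> (\<lambda>x. f x + g x *v \<mu> x)"
  using cont_f cont_g continuous_on_\<mu>
  by (intro continuous_on_add bounded_bilinear.continuous_on[OF bounded_bilinear_matrix_vector_mult])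
    (auto intro: continuous_on_subset)

lemma has_vector_derivative_v_compose:
  assumes "(x has_vector_derivative d) (at t within S)" "x t \<in> \<Omega>"
  shows "((\<lambda>t. v (x t)) has_vector_derivative d \<bullet> grad v (x t)) (at t within S)"
  using has_derivative_compose[OF assms(1)[unfolded has_vector_derivative_def]
      C1_on_has_derivative_grad[OF C1_v assms(2)]]
  by (simp add: has_vector_derivative_def)

lemma v_pos:
  assumes "x \<in> \<Omega>" "x \<noteq> 0"
  shows "v x > 0"
proof (rule ccontr)
  assume "\<not> v x > 0"
  then have "v x = 0" using v_nonneg[OF assms(1)] by simp
  then have "(\<lambda>h. h \<bullet> grad v x) = (\<lambda>h. 0)"
    using v_nonneg by (intro differential_zero_maxmin[OF assms(1) open_\<Omega> C1_on_has_derivative_grad[OF C1_v assms(1)]]) auto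
  then have "grad v x \<bullet> grad v x = 0" by meson
  then have "grad v x = 0" by simp
  then have "\<kappa> x (\<mu> x) = 0" using bellman_equality[OF assms(1)] by simp
  then show False using h_le_cost[of x "\<mu> x"] h_pos[OF assms(2)] by simp
qed

text \<open>Away from the origin \<open>h\<close> has a positive minimum on the annulus, which pays
  for the drift. The control part of the speed is linear in \<open>norm w\<close>, while the cost
  grows quadratically by coercivity of \<open>R\<close>.\<close>

lemma speed_le_cost_on_annulus:
  assumes "\<rho> > 0"
  obtains K where "K > 0" "\<And>x w. \<rho> \<le> norm x \<Longrightarrow> norm x \<le> 2 * \<rho> \<Longrightarrow> norm (f x + g x *v w) \<le> K * \<kappa> x w"
proof -
  let ?A = "cball 0 (2 * \<rho>) \<inter> - ball (0 :: real ^ 'n) \<rho>"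
  have cpt: "compact ?A" by (intro compact_Int_closed compact_cball) auto
  have bdd: "\<exists>B>0. \<forall>x\<in>?A. norm (p x) \<le> B" if "continuous_on UNIV p"
    for p :: "real ^ 'n \<Rightarrow> 'b::real_normed_vector"
    using compact_imp_bounded[OF compact_continuous_image[OF continuous_on_subset[OF that subset_UNIV] cpt]]
    by (auto simp: bounded_pos)
  obtain F where F: "F > 0" "\<And>x. x \<in> ?A \<Longrightarrow> norm (f x) \<le> F" using bdd[OF cont_f] by blast
  obtain G where G: "G > 0" "\<And>x. x \<in> ?A \<Longrightarrow> norm (g x) \<le> G" using bdd[OF cont_g] by blast
  obtain k where k: "k > 0" "\<And>(M::real ^ 'm ^ 'n) w. norm (M *v w) \<le> k * norm M * norm w"
    using norm_matrix_vector_mult_le by blast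
  obtain c where c: "c > 0" "\<And>w. c * (norm w)\<^sup>2 \<le> w \<bullet> (R *v w)"
    using sym_pos_def_coercive[OF R] by blast
  obtain a where a: "a > 0" "\<And>x. x \<in> ?A \<Longrightarrow> a \<le> h x"
  proof (cases "?A = {}")
    case False
    then obtain y where "y \<in> ?A" "\<And>x. x \<in> ?A \<Longrightarrow> h y \<le> h x"
      using continuous_attains_inf[OF cpt _ continuous_on_subset[OF cont_h]] by blast
    moreover from this(1) have "y \<noteq> 0" using \<open>\<rho> > 0\<close> by auto
    ultimately show thesis using h_pos[of y] by (intro that[of "h y"]) auto
  qed (use that[of 1] in auto)
  let ?K = "(F + k * G) / a + k * G / c"
  show thesis
  proof (rule that)
    show "?K > 0" using F(1) G(1) k(1) a(1) c(1) by (simp add: add_pos_pos)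
    fix x :: "real ^ 'n" and w assume "\<rho> \<le> norm x" "norm x \<le> 2 * \<rho>"
    then have x: "x \<in> ?A" by auto
    have kG: "k * G > 0" using k(1) G(1) by simp
    have "norm (f x + g x *v w) \<le> F + k * G * norm w"
    proof (rule norm_triangle_le[OF add_mono])
      show "norm (f x) \<le> F" using F(2)[OF x] .
      show "norm (g x *v w) \<le> k * G * norm w"
        using G(2)[OF x] k(1) by (intro order_trans[OF k(2)] mult_right_mono mult_left_mono) auto
    qed
    also have "\<dots> \<le> F + k * G * (1 + (norm w)\<^sup>2)"
    proof -
      \<comment> \<open>The constant part of this bound is charged to \<open>h\<close>, the
        quadratic part to the form of \<open>R\<close>.\<close>
      have "norm w \<le> 1 + (norm w)\<^sup>2"
        using zero_le_power2[of "norm w - 1 / 2"] by (simp add: power2_eq_square algebra_simps)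
      then show ?thesis using kG by (intro add_left_mono mult_left_mono) auto
    qed
    also have "\<dots> = (F + k * G) / a * a + k * G / c * (c * (norm w)\<^sup>2)"
      using a(1) c(1) by (simp add: distrib_left)
    also have "\<dots> \<le> (F + k * G) / a * \<kappa> x w + k * G / c * \<kappa> x w"
    proof (intro add_mono mult_left_mono)
      show "a \<le> \<kappa> x w" using a(2)[OF x] h_le_cost[of x w] by simp
      show "c * (norm w)\<^sup>2 \<le> \<kappa> x w" using c(2)[of w] h_nonneg[of x] by (simp add: running_cost_def)
    qed (use F(1) kG a(1) c(1) in auto)
    also have "\<dots> = ?K * \<kappa> x w" by (simp add: distrib_right)
    finally show "norm (f x + g x *v w) \<le> ?K * \<kappa> x w" .
  qed
qed

lemma subset_\<Omega>_imp_lipschitz: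
  assumes "cball 0 r \<subseteq> \<Omega>"
  obtains L where "L-lipschitz_on (cball 0 r) v"
  using C1_on_imp_lipschitz_on[OF C1_v compact_cball convex_cball assms] .

text \<open>To get from inside radius \<rho> to beyond 2 \<rho>, a trajectory must cover a distance
  of at least \<rho> within the annulus, which costs at least \<rho> / K.\<close>

lemma finite_cost_stays_in_ball:
  assumes sol: "caratheodory_solution f g u x0 \<infinity> x"
    and meas: "u \<in> borel_measurable (lebesgue_on {0..})"
    and I: "(\<integral>\<^sup>+t\<in>{0..}. ennreal (\<kappa> (x t) (u t)) \<partial>lebesgue) = ennreal I" "I \<ge> 0"
    and K: "K > 0" "\<And>x w. \<rho> \<le> norm x \<Longrightarrow> norm x \<le> 2 * \<rho> \<Longrightarrow> norm (f x + g x *v w) \<le> K * \<kappa> x w"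
    and small: "norm x0 < \<rho>" "K * I < \<rho>" and "t \<ge> 0"
  shows "norm (x t) \<le> 2 * \<rho>"
proof (rule ccontr)
  assume out: "\<not> norm (x t) \<le> 2 * \<rho>"
  have cx: "continuous_on {0..b} x" for b by (rule caratheodory_solution_continuous_on[OF sol])
  have x0: "x 0 = x0" using sol by (simp add: caratheodory_solution_def)
  have "\<rho> > 0" using small(1) norm_ge_zero[of x0] by linarith
  have cn: "continuous_on {0..t} (\<lambda>r. norm (x r))" by (intro continuous_on_norm cx)
  have "norm (x 0) < \<rho>" "\<rho> < 2 * \<rho>" "2 * \<rho> \<le> norm (x t)" using small(1) x0 \<open>\<rho> > 0\<close> out by auto
  from crossing_interval[OF cn \<open>t \<ge> 0\<close> this] obtain a b where ab:
    "0 \<le> a" "a \<le> b" "b \<le> t" "norm (x a) = \<rho>" "norm (x b) = 2 * \<rho>"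
    "\<And>r. r \<in> {a..b} \<Longrightarrow> \<rho> \<le> norm (x r) \<and> norm (x r) \<le> 2 * \<rho>" by blast
  have measc: "(\<lambda>t. \<kappa> (x t) (u t)) \<in> borel_measurable (lebesgue_on {0..})"
    by (rule running_cost_measurable[OF continuous_on_atLeast[OF cx] cont_h meas])
  note int = nn_integral_atLeast_finite[OF measc cost_nonneg I ab(1), of b]
  note der = caratheodory_solution_has_integral[OF sol ab(1,2)]
  have "\<rho> \<le> norm (x b - x a)" using ab(4,5) norm_triangle_ineq2[of "x b" "x a"] by simp
  also have "\<dots> = norm (integral {a..b} (\<lambda>r. f (x r) + g (x r) *v u r))"
    using integral_unique[OF der] by simp
  also have "\<dots> \<le> integral {a..b} (\<lambda>r. K * \<kappa> (x r) (u r))"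
    using ab(6) K(2)
    by (intro Henstock_Kurzweil_Integration.integral_norm_bound_integral has_integral_integrable[OF der]
        integrable_on_mult_right int(1)) auto
  also have "\<dots> \<le> K * I" using int(2) K(1) by simp
  finally show False using small(2) by simp
qed

text \<open>Convergence of the trajectory to the origin is never shown. Since
  \<open>decrease\<close> holds for every time, it is enough that \<open>v\<close> falls below each
  positive level at some time.\<close>

lemma v_le_cost_of_trajectory_in_\<Omega>:
  assumes sol: "caratheodory_solution f g u x0 \<infinity> x" and u: "u \<in> U_inf"
    and I: "(\<integral>\<^sup>+t\<in>{0..}. ennreal (\<kappa> (x t) (u t)) \<partial>lebesgue) = ennreal I" "I \<ge> 0"
    and r: "cball 0 r \<subseteq> \<Omega>" "\<And>t. t \<ge> 0 \<Longrightarrow> norm (x t) \<le> r"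
  shows "v x0 \<le> I"
proof -
  have x0: "x 0 = x0" using sol by (simp add: caratheodory_solution_def)
  have in\<Omega>: "x t \<in> \<Omega>" if "t \<ge> 0" for t using r that by auto
  have cx: "continuous_on {0..b} x" for b by (rule caratheodory_solution_continuous_on[OF sol])
  have meas: "u \<in> borel_measurable (lebesgue_on {0..})" using u by (simp add: U_inf_def)
  have measc: "(\<lambda>t. \<kappa> (x t) (u t)) \<in> borel_measurable (lebesgue_on {0..})"
    by (rule running_cost_measurable[OF continuous_on_atLeast[OF cx] cont_h meas])
  note int = nn_integral_atLeast_finite[OF measc cost_nonneg I order_refl]
  obtain Lv where Lv: "Lv-lipschitz_on (cball 0 r) v" using subset_\<Omega>_imp_lipschitz[OF r(1)] .
  obtain E where E: "negligible E"
    "\<And>t. 0 \<le> t \<Longrightarrow> t \<notin> E \<Longrightarrow> (x has_vector_derivative f (x t) + g (x t) *v u t) (at t)"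
    using caratheodory_solution_derivative[OF sol] by blast
  have decrease: "v x0 \<le> v (x T) + I" if "T \<ge> 0" for T
  proof -
    obtain Lx where Lx: "Lx-lipschitz_on {0..T} x"
      using caratheodory_solution_lipschitz_on[OF sol u cont_f cont_g] .
    have "x ` {0..T} \<subseteq> cball 0 r" using r(2) by auto
    then have "(Lv * Lx)-lipschitz_on {0..T} (\<lambda>t. v (x t))"
      using lipschitz_on_compose2[OF Lx] lipschitz_on_subset[OF Lv] by blast
    then have ac: "abs_cont_on 0 T (\<lambda>t. v (x t))" by (rule lipschitz_on_imp_abs_cont_on)
    let ?D = "\<lambda>t. (f (x t) + g (x t) *v u t) \<bullet> grad v (x t)"
    have "(?D has_integral v (x T) - v (x 0)) {0..T}"
    proof (rule has_integral_abs_cont_on[OF that ac E(1)])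
      fix t assume t: "t \<in> {0..T} - E"
      have "(x has_vector_derivative f (x t) + g (x t) *v u t) (at t within {0..T})"
        using E(2)[of t] t by (auto intro: has_vector_derivative_at_within)
      then show "((\<lambda>t. v (x t)) has_vector_derivative ?D t) (at t within {0..T})"
        by (rule has_vector_derivative_v_compose) (use in\<Omega> t in auto)
    qed
    then have "v (x T) - v (x 0) \<ge> - integral {0..T} (\<lambda>t. \<kappa> (x t) (u t))"
      by (rule has_integral_le[OF has_integral_neg[OF integrable_integral[OF int(1)]]])
        (use bellman_inequality in\<Omega> in auto)
    then show ?thesis using int(2)[of T] x0 by simp
  qed
  have small: "\<exists>T\<ge>0. v (x T) < \<epsilon>" if "\<epsilon> > 0" for \<epsilon>
  proof (rule ccontr)
    assume "\<not> (\<exists>T\<ge>0. v (x T) < \<epsilon>)"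
    then have ge: "v (x t) \<ge> \<epsilon>" if "t \<ge> 0" for t using that by force
    \<comment> \<open>If \<open>v\<close> stayed at least \<epsilon>, the trajectory would stay in
      this compact set, which avoids the origin because \<open>v 0 = 0\<close>; there
      \<open>h\<close> has a positive minimum.\<close>
    define S where "S = {y \<in> cball 0 r. \<epsilon> \<le> v y}"
    have "closed S" unfolding S_def
      using continuous_closed_preimage[OF continuous_on_subset[OF cont_v r(1)] closed_cball closed_atLeast, of \<epsilon>]
      by (simp add: vimage_def Int_def)
    moreover have "bounded S" by (rule bounded_subset[OF bounded_cball[of 0 r]]) (auto simp: S_def)
    ultimately have "compact S" by (simp add: compact_eq_bounded_closed)
    moreover have "x t \<in> S" if "t \<ge> 0" for t using ge[OF that] r(2)[OF that] by (simp add: S_def)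
    moreover from this[of 0] have "S \<noteq> {}" by auto
    ultimately obtain y where y: "y \<in> S" "\<And>t. t \<ge> 0 \<Longrightarrow> h y \<le> h (x t)"
      using continuous_attains_inf[of S h] continuous_on_subset[OF cont_h] by blast
    have "y \<noteq> 0" using y(1) \<open>\<epsilon> > 0\<close> v_0 by (auto simp: S_def)
    then have hy: "h y > 0" by (rule h_pos)
    \<comment> \<open>At this time the cost is at least \<open>T * h y = I + h y\<close>, more than
      the total \<open>I\<close>.\<close>
    define T where "T = I / h y + 1"
    have "T \<ge> 0" using I(2) hy by (simp add: T_def)
    have "((\<lambda>t. h y) has_integral T * h y) {0..T}"
      using has_integral_const_real[of "h y" 0 T] \<open>T \<ge> 0\<close> by simp
    then have "T * h y \<le> integral {0..T} (\<lambda>t. \<kappa> (x t) (u t))"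
      using y(2) h_le_cost by (intro has_integral_le[OF _ integrable_integral[OF int(1)]]) (auto intro: order_trans)
    also have "\<dots> \<le> I" by (rule int(2))
    finally show False using hy by (simp add: T_def distrib_right)
  qed
  have "v x0 \<le> I + \<epsilon>" if "\<epsilon> > 0" for \<epsilon>
  proof -
    from small[OF that]
    obtain T where "T \<ge> 0" "v (x T) < \<epsilon>" by blast
    then show ?thesis using decrease[of T] by simp
  qed
  then show ?thesis by (rule field_le_epsilon)
qed

end

section \<open>Closed-loop trajectories\<close>

lemma time_interval_mono: "s \<in> time_interval T \<Longrightarrow> {0..s} \<subseteq> time_interval T"
  unfolding time_interval_def by (auto intro: le_less_trans[of "ereal _" "ereal s"])

lemma (in hjb_solution) closed_loop_dissipation:
  assumes "0 \<le> s"
    and der: "\<And>r. r \<in> {0..s} \<Longrightarrow> (x has_vector_derivative f (x r) + g (x r) *v \<mu> (x r)) (at r within {0..s})"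
    and in\<Omega>: "\<And>r. r \<in> {0..s} \<Longrightarrow> x r \<in> \<Omega>"
  shows "((\<lambda>r. \<kappa> (x r) (\<mu> (x r))) has_integral v (x 0) - v (x s)) {0..s}"
proof -
  have "((\<lambda>r. - \<kappa> (x r) (\<mu> (x r))) has_integral v (x s) - v (x 0)) {0..s}"
  proof (rule fundamental_theorem_of_calculus[OF \<open>0 \<le> s\<close>])
    fix r assume r: "r \<in> {0..s}"
    from has_vector_derivative_v_compose[OF der[OF r] in\<Omega>[OF r]]
    show "((\<lambda>r. v (x r)) has_vector_derivative - \<kappa> (x r) (\<mu> (x r))) (at r within {0..s})"
      by (simp only: bellman_equality[OF in\<Omega>[OF r]])
  qed
  from has_integral_neg[OF this] show ?thesis by simp
qed

text \<open>\<open>c\<close> is any lower bound on the sphere, not the minimum itself, because its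
  final choice must also respect the price of leaving a larger ball.\<close>

locale hjb_basin = hjb_solution f g h R \<Omega> v
  for f :: "real ^ 'n \<Rightarrow> real ^ 'n" and g :: "real ^ 'n \<Rightarrow> real ^ 'm ^ 'n" and h R \<Omega> v +
  fixes \<rho> c :: real
  assumes \<rho>_pos: "\<rho> > 0" and cball_subset: "cball 0 \<rho> \<subseteq> \<Omega>"
    and barrier: "\<And>y. norm y = \<rho> \<Longrightarrow> c \<le> v y"
begin

text \<open>The cut with the ball discards parts of the sublevel set farther out, where
  \<open>v\<close> may again drop below \<open>c\<close>.\<close>

definition basin :: "(real ^ 'n) set" where
  "basin = {y \<in> ball 0 \<rho>. v y < c}"

lemma basin_subset: "basin \<subseteq> \<Omega>"
  using cball_subset by (auto simp: basin_def)

text \<open>At a first contact with the sphere, dissipation would give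
  \<open>v (x s') \<le> v (x 0) < c\<close>, against the barrier. The field \<open>G\<close> has to
  match the closed loop only on the ball, so the lemma also applies to the globally extended field
  used for existence.\<close>

lemma basin_invariant:
  assumes der: "\<And>t. t \<in> time_interval T \<Longrightarrow> (x has_vector_derivative G (x t)) (at t within time_interval T)"
    and G: "\<And>y. norm y \<le> \<rho> \<Longrightarrow> G y = f y + g y *v \<mu> y"
    and x0: "x 0 \<in> basin" and t: "t \<in> time_interval T"
  shows "x t \<in> basin" "v (x t) \<le> v (x 0)"
proof -
  have decrease: "v (x s) \<le> v (x 0)"
    if s: "s \<in> time_interval T" and le: "\<And>r. r \<in> {0..s} \<Longrightarrow> norm (x r) \<le> \<rho>" for s
  proof -
    have "0 \<le> s" using s by (simp add: time_interval_def)
    have sub: "{0..s} \<subseteq> time_interval T" using s by (rule time_interval_mono)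
    have "((\<lambda>r. \<kappa> (x r) (\<mu> (x r))) has_integral v (x 0) - v (x s)) {0..s}"
    proof (rule closed_loop_dissipation[OF \<open>0 \<le> s\<close>])
      fix r assume r: "r \<in> {0..s}"
      show "x r \<in> \<Omega>" using le[OF r] cball_subset by auto
      have "(x has_vector_derivative G (x r)) (at r within {0..s})"
        using der[of r] sub r by (meson has_vector_derivative_within_subset subsetD)
      then show "(x has_vector_derivative f (x r) + g (x r) *v \<mu> (x r)) (at r within {0..s})"
        using G[OF le[OF r]] by simp
    qed
    then have "0 \<le> v (x 0) - v (x s)" by (rule has_integral_nonneg) (rule cost_nonneg)
    then show ?thesis by simp
  qed
  have inside: "norm (x s) < \<rho>" if s: "s \<in> time_interval T" for s
  proof (rule ccontr)
    assume "\<not> norm (x s) < \<rho>"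
    have "0 \<le> s" using s by (simp add: time_interval_def)
    have sub: "{0..s} \<subseteq> time_interval T" using s by (rule time_interval_mono)
    have "continuous_on (time_interval T) x"
      using der by (meson continuous_on_eq_continuous_within has_vector_derivative_continuous)
    then have "continuous_on {0..s} (\<lambda>r. norm (x r))"
      using sub by (intro continuous_on_norm) (rule continuous_on_subset)
    moreover have "norm (x 0) < \<rho>" using x0 by (simp add: basin_def)
    moreover have "\<rho> \<le> norm (x s)" using \<open>\<not> norm (x s) < \<rho>\<close> by simp
    ultimately obtain s' where s': "0 < s'" "s' \<le> s" "norm (x s') = \<rho>"
      "\<And>r. 0 \<le> r \<Longrightarrow> r < s' \<Longrightarrow> norm (x r) < \<rho>"
      using first_hitting_time[of 0 s "\<lambda>r. norm (x r)" \<rho>] \<open>0 \<le> s\<close> by blast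
    have "v (x s') \<le> v (x 0)"
    proof (rule decrease)
      show "s' \<in> time_interval T" using sub s' by auto
      show "norm (x r) \<le> \<rho>" if "r \<in> {0..s'}" for r
        using s'(3) s'(4)[of r] that by (cases "r = s'") auto
    qed
    then show False using barrier[OF s'(3)] x0 by (simp add: basin_def)
  qed
  show "v (x t) \<le> v (x 0)"
    using time_interval_mono[OF t] by (intro decrease[OF t] less_imp_le inside) auto
  then show "x t \<in> basin" using inside[OF t] x0 by (simp add: basin_def)
qed

lemma closed_loop_bound:
  obtains B where "B \<ge> 0" "\<And>y. norm y \<le> \<rho> \<Longrightarrow> norm (f y + g y *v \<mu> y) \<le> B"
proof -
  have "bounded ((\<lambda>y. f y + g y *v \<mu> y) ` cball 0 \<rho>)"
    using continuous_on_subset[OF continuous_on_closed_loop cball_subset]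
    by (intro compact_imp_bounded compact_continuous_image) auto
  then obtain B where "\<forall>y\<in>cball 0 \<rho>. norm (f y + g y *v \<mu> y) \<le> B" by (auto simp: bounded_iff)
  moreover from this have "norm (f 0 + g 0 *v \<mu> 0) \<le> B" using \<rho>_pos by simp
  then have "B \<ge> 0" using norm_ge_zero order_trans by blast
  ultimately show thesis by (intro that[of B]) auto
qed

lemma global_closed_loop_solution:
  assumes "x0 \<in> basin"
  obtains x where "closed_loop_solution f g \<Omega> \<mu> x0 \<infinity> x" "continuous_on {0..} x"
proof -
  \<comment> \<open>Composing with the projection onto the ball extends the closed-loop field to a
    bounded continuous field on the whole space, as Peano requires. Invariance of the basin shows
    that the solution never sees the modification.\<close>
  define \<pi> where "\<pi> = closest_point (cball (0 :: real ^ 'n) \<rho>)"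
  define G where "G y = f (\<pi> y) + g (\<pi> y) *v \<mu> (\<pi> y)" for y
  have \<pi>: "norm (\<pi> y) \<le> \<rho>" for y
    using closest_point_in_set[of "cball 0 \<rho>" y] \<rho>_pos by (auto simp: \<pi>_def)
  have "continuous_on UNIV \<pi>"
    unfolding \<pi>_def using \<rho>_pos by (intro continuous_on_closest_point) auto
  then have cont: "continuous_on UNIV G" unfolding G_def
    using \<pi> cball_subset by (intro continuous_on_compose2[OF continuous_on_closed_loop]) auto
  obtain B where B: "\<And>y. norm y \<le> \<rho> \<Longrightarrow> norm (f y + g y *v \<mu> y) \<le> B"
    using closed_loop_bound by blast
  have "norm (G y) \<le> B" for y unfolding G_def using \<pi> by (rule B)
  from peano_global[OF cont this, of x0]
  obtain x :: "real \<Rightarrow> real ^ 'n" where x: "x 0 = x0" "continuous_on {0..} x"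
    "\<And>t. t \<ge> 0 \<Longrightarrow> ((\<lambda>s. G (x s)) has_integral x t - x0) {0..t}"
    by blast
  have der: "(x has_vector_derivative G (x t)) (at t within {0..})" if "t \<ge> 0" for t
    by (rule integral_equation_imp_has_vector_derivative[OF x(2) cont _ x(3) that]) auto
  have G: "G y = f y + g y *v \<mu> y" if "norm y \<le> \<rho>" for y
    using closest_point_self[of y "cball 0 \<rho>"] that by (simp add: G_def \<pi>_def)
  have basin: "x t \<in> basin" if "t \<ge> 0" for t
    by (rule basin_invariant(1)[of \<infinity> x G]) (use der G assms x(1) that in auto)
  have "closed_loop_solution f g \<Omega> \<mu> x0 \<infinity> x"
    unfolding closed_loop_solution_def
  proof (intro conjI ballI)
    fix t assume "t \<in> time_interval \<infinity>"
    then have t: "t \<ge> 0" by simp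
    show "x t \<in> \<Omega>" using basin[OF t] basin_subset by blast
    have "norm (x t) \<le> \<rho>" using basin[OF t] by (simp add: basin_def)
    then show "(x has_vector_derivative f (x t) + g (x t) *v \<mu> (x t)) (at t within time_interval \<infinity>)"
      using der[OF t] G by simp
  qed (use x(1) in auto)
  then show thesis using x(2) by (rule that)
qed

lemma closed_loop_solution_in_basin:
  assumes "closed_loop_solution f g \<Omega> \<mu> x0 T x" "x0 \<in> basin" "t \<in> time_interval T"
  shows "x t \<in> basin" "v (x t) \<le> v x0"
proof -
  have der: "(x has_vector_derivative f (x t) + g (x t) *v \<mu> (x t)) (at t within time_interval T)"
    if "t \<in> time_interval T" for t
    using assms(1) that by (simp add: closed_loop_solution_def)
  have x0: "x 0 = x0" using assms(1) by (simp add: closed_loop_solution_def)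
  show "x t \<in> basin" "v (x t) \<le> v x0"
    using basin_invariant[of T x "\<lambda>y. f y + g y *v \<mu> y" t, OF der] assms(2,3) x0 by auto
qed

text \<open>Without uniqueness, one global trajectory says nothing about the other maximal ones.
  Each is shown to be extendable: bounded speed gives a limit at a finite end time, and a new Peano
  solution is attached there.\<close>

lemma maximal_closed_loop_solution_global:
  assumes max: "maximal_solution (closed_loop_solution f g \<Omega> \<mu> x0) T x" and x0: "x0 \<in> basin"
  shows "T = \<infinity>"
proof (rule ccontr)
  assume "T \<noteq> \<infinity>"
  have sol: "closed_loop_solution f g \<Omega> \<mu> x0 T x" using max by (simp add: maximal_solution_def)
  then have "0 < T" by (simp add: closed_loop_solution_def)
  then obtain b where T: "T = ereal b" and "b > 0" using \<open>T \<noteq> \<infinity>\<close> by (cases T) auto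
  have ti: "time_interval T = {0..<b}" by (auto simp: time_interval_def T)
  have basin: "x t \<in> basin" "v (x t) \<le> v x0" if "t \<in> {0..<b}" for t
    using closed_loop_solution_in_basin[OF sol x0] that ti by auto
  have der: "(x has_vector_derivative f (x t) + g (x t) *v \<mu> (x t)) (at t within {0..<b})" if "t \<in> {0..<b}" for t
    using sol that ti by (simp add: closed_loop_solution_def)
  obtain B where B: "B \<ge> 0" "\<And>y. norm y \<le> \<rho> \<Longrightarrow> norm (f y + g y *v \<mu> y) \<le> B"
    using closed_loop_bound by blast
  have "B-lipschitz_on {0..<b} x"
  proof (rule bounded_derivative_imp_lipschitz[OF _ _ _ B(1)])
    fix t assume t: "t \<in> {0..<b}"
    show "(x has_derivative (\<lambda>h. h *\<^sub>R (f (x t) + g (x t) *v \<mu> (x t)))) (at t within {0..<b})"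
      using der[OF t] by (simp add: has_vector_derivative_def)
    show "onorm (\<lambda>h. h *\<^sub>R (f (x t) + g (x t) *v \<mu> (x t))) \<le> B"
    proof (rule onorm_le)
      fix h :: real
      have "norm (f (x t) + g (x t) *v \<mu> (x t)) \<le> B" using basin(1)[OF t] by (intro B(2)) (simp add: basin_def)
      from mult_left_mono[OF this norm_ge_zero[of h]]
      show "norm (h *\<^sub>R (f (x t) + g (x t) *v \<mu> (x t))) \<le> B * norm h"
        by (simp add: mult.commute)
    qed
  qed simp
  then obtain x' where x': "B-lipschitz_on {0..b} x'" "\<And>t. t \<in> {0..<b} \<Longrightarrow> x' t = x t"
    using lipschitz_extend_closure[of B "{0..<b}" x] \<open>b > 0\<close> by auto
  have x'c: "continuous_on {0..b} x'" using x'(1) by (rule lipschitz_on_continuous_on)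
  \<comment> \<open>The limit could lie on the sphere a priori. Closedness of \<open>C\<close> keeps
    \<open>v (x' b) \<le> v x0 < c\<close>, so the barrier excludes that and the restart point is in
    the basin.\<close>
  define C where "C = {y \<in> cball 0 \<rho>. v y \<le> v x0}"
  have "closed C" unfolding C_def
    using continuous_closed_preimage[OF continuous_on_subset[OF cont_v cball_subset] closed_cball closed_atMost, of "v x0"]
    by (simp add: vimage_def Int_def)
  moreover have "x' ` {0..<b} \<subseteq> C" using basin x'(2) by (auto simp: C_def basin_def less_imp_le)
  ultimately have "x' ` closure {0..<b} \<subseteq> C" using \<open>b > 0\<close> x'c by (intro image_closure_subset) auto
  then have "x' b \<in> C" using \<open>b > 0\<close> by auto
  then have "x' b \<in> basin"
    using x0 barrier[of "x' b"] by (cases "norm (x' b) = \<rho>") (auto simp: C_def basin_def)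
  then obtain y where y: "closed_loop_solution f g \<Omega> \<mu> (x' b) \<infinity> y" "continuous_on {0..} y"
    using global_closed_loop_solution by blast
  have y0: "y 0 = x' b" using y(1) by (simp add: closed_loop_solution_def)
  define z where "z t = (if t \<le> b then x' t else y (t - b))" for t
  have zx: "z t = x t" if "t \<in> {0..<b}" for t using x'(2)[OF that] that by (simp add: z_def)
  have cz: "continuous_on {0..} z" unfolding z_def
  proof (rule continuous_on_cases_le)
    show "continuous_on {t \<in> {0..}. t \<le> b} x'" by (rule continuous_on_subset[OF x'c]) auto
    show "continuous_on {t \<in> {0..}. b \<le> t} (\<lambda>t. y (t - b))"
      by (intro continuous_on_compose2[OF y(2)] continuous_intros) auto
  qed (use y0 in \<open>auto intro: continuous_intros\<close>)
  have z0: "z 0 = x0" using zx[of 0] sol \<open>b > 0\<close> by (simp add: closed_loop_solution_def)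
  have z\<Omega>: "z t \<in> \<Omega>" if "t \<ge> 0" for t
  proof (cases "t \<le> b")
    case True
    then show ?thesis
      using basin(1)[of t] zx[of t] \<open>x' b \<in> basin\<close> basin_subset that by (cases "t = b") (auto simp: z_def)
  next
    case False
    then show ?thesis using y(1) by (simp add: z_def closed_loop_solution_def)
  qed
  \<comment> \<open>The glued curve is checked through its integral equation, which tolerates the
    seam \<open>b\<close>; differentiating it back gives the derivative at the seam as well.\<close>
  have int: "((\<lambda>t. f (z t) + g (z t) *v \<mu> (z t)) has_integral z t - x0) {0..t}" if "t \<ge> 0" for t
  proof -
    have "((\<lambda>t. f (z t) + g (z t) *v \<mu> (z t)) has_integral z t - z 0) {0..t}"
    proof (rule fundamental_theorem_of_calculus_interior_strong[of "{b}"])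
      show "continuous_on {0..t} z" by (rule continuous_on_subset[OF cz]) auto
      fix s assume s: "s \<in> {0<..<t} - {b}"
      show "(z has_vector_derivative f (z s) + g (z s) *v \<mu> (z s)) (at s)"
      proof (cases "s < b")
        case True
        have "(x has_vector_derivative f (x s) + g (x s) *v \<mu> (x s)) (at s within {0<..<b})"
          using der[of s] s True by (auto intro: has_vector_derivative_within_subset)
        then have "(x has_vector_derivative f (z s) + g (z s) *v \<mu> (z s)) (at s)"
          using zx[of s] s True at_within_open[of s "{0<..<b}"] by simp
        then show ?thesis
          by (rule has_vector_derivative_transform_within_open[of _ _ _ "{0<..<b}"]) (use s True zx in auto)
      next
        case False
        then have sb: "s - b > 0" using s by simp
        have "(y has_vector_derivative f (y (s - b)) + g (y (s - b)) *v \<mu> (y (s - b))) (at (s - b) within {0<..})"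
        proof (rule has_vector_derivative_within_subset)
          show "(y has_vector_derivative f (y (s - b)) + g (y (s - b)) *v \<mu> (y (s - b))) (at (s - b) within {0..})"
            using y(1) sb by (simp add: closed_loop_solution_def)
        qed auto
        then have "(y has_vector_derivative f (y (s - b)) + g (y (s - b)) *v \<mu> (y (s - b))) (at (s - b))"
          using sb at_within_open[of "s - b" "{0<..}"] by simp
        moreover have "((\<lambda>s. s - b) has_vector_derivative 1) (at s)"
          by (auto intro!: derivative_eq_intros)
        ultimately have "((\<lambda>s. y (s - b)) has_vector_derivative f (z s) + g (z s) *v \<mu> (z s)) (at s)"
          using vector_diff_chain_at[of "\<lambda>s. s - b" 1 s y] sb by (simp add: o_def z_def)
        then show ?thesis
          by (rule has_vector_derivative_transform_within_open[of _ _ _ "{b<..}"]) (use sb in \<open>auto simp: z_def\<close>)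
      qed
    qed (use that in auto)
    then show ?thesis using z0 by simp
  qed
  have "closed_loop_solution f g \<Omega> \<mu> x0 \<infinity> z"
    unfolding closed_loop_solution_def time_interval_infinity
    using integral_equation_imp_has_vector_derivative[OF cz continuous_on_closed_loop z\<Omega> int] z0 z\<Omega> by auto
  then have "\<infinity> = T"
    using max[unfolded maximal_solution_def, THEN conjunct2, rule_format, of \<infinity> z] zx ti by simp
  then show False using T by simp
qed

end

section \<open>Local optimality of the feedback\<close>

lemma maximal_solution_infinity: "P \<infinity> x \<Longrightarrow> maximal_solution P \<infinity> x"
  by (simp add: maximal_solution_def)

lemma cost_cases:
  obtains "cost f g h R x0 u = \<infinity>"
  | x where "caratheodory_solution f g u x0 \<infinity> x"
      "cost f g h R x0 u = (\<integral>\<^sup>+t\<in>{0..}. ennreal (running_cost h R (x t) (u t)) \<partial>lebesgue)"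
proof (cases "\<exists>x. maximal_solution (caratheodory_solution f g u x0) \<infinity> x")
  case True
  define x where "x = (SOME x. maximal_solution (caratheodory_solution f g u x0) \<infinity> x)"
  have "maximal_solution (caratheodory_solution f g u x0) \<infinity> x"
    unfolding x_def using True by (rule someI_ex)
  then have "caratheodory_solution f g u x0 \<infinity> x" by (simp add: maximal_solution_def)
  moreover have "cost f g h R x0 u = (\<integral>\<^sup>+t\<in>{0..}. ennreal (running_cost h R (x t) (u t)) \<partial>lebesgue)"
    using True by (simp add: cost_def running_cost_def x_def[symmetric])
  ultimately show thesis by (rule that(2))
next
  case False
  then have "cost f g h R x0 u = \<infinity>" by (simp only: cost_def if_False)
  then show thesis by (rule that(1))
qed

text \<open>By uniqueness the trajectory picked by \<open>SOME\<close> in \<open>cost\<close> agrees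
  with the given one on \<open>{0..}\<close>.\<close>

lemma cost_eq_nn_integral:
  fixes f :: "real ^ 'n \<Rightarrow> real ^ 'n" and g :: "real ^ 'n \<Rightarrow> real ^ 'm ^ 'n"
  assumes sol: "caratheodory_solution f g u x0 \<infinity> x" and "u \<in> U_inf"
    and C1: "C1_on f UNIV" "C1_on g UNIV"
  shows "cost f g h R x0 u = (\<integral>\<^sup>+t\<in>{0..}. ennreal (running_cost h R (x t) (u t)) \<partial>lebesgue)"
proof -
  define y where "y = (SOME x. maximal_solution (caratheodory_solution f g u x0) \<infinity> x)"
  have ex: "\<exists>x. maximal_solution (caratheodory_solution f g u x0) \<infinity> x"
    using maximal_solution_infinity[of "caratheodory_solution f g u x0", OF sol] by blast
  then have "maximal_solution (caratheodory_solution f g u x0) \<infinity> y"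
    unfolding y_def by (rule someI_ex)
  then have y: "caratheodory_solution f g u x0 \<infinity> y" by (simp add: maximal_solution_def)
  have "cost f g h R x0 u = (\<integral>\<^sup>+t\<in>{0..}. ennreal (running_cost h R (y t) (u t)) \<partial>lebesgue)"
    using ex by (simp add: cost_def running_cost_def y_def[symmetric])
  also have "\<dots> = (\<integral>\<^sup>+t\<in>{0..}. ennreal (running_cost h R (x t) (u t)) \<partial>lebesgue)"
    using caratheodory_solution_unique[OF y sol \<open>u \<in> U_inf\<close> C1]
    by (intro nn_integral_cong) (auto simp: indicator_def)
  finally show ?thesis .
qed

text \<open>Monotone convergence over the intervals \<open>{0..real n}\<close> turns uniform bounds
  for gauge integrals into a bound for the Lebesgue integral.\<close>

lemma nn_integral_atLeast_le:
  fixes \<phi> :: "real \<Rightarrow> real"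
  assumes meas: "\<phi> \<in> borel_measurable (lebesgue_on {0..})" and nn: "\<And>t. \<phi> t \<ge> 0"
    and int: "\<And>b. b \<ge> 0 \<Longrightarrow> \<phi> integrable_on {0..b}" "\<And>b. b \<ge> 0 \<Longrightarrow> integral {0..b} \<phi> \<le> I"
  shows "(\<integral>\<^sup>+t\<in>{0..}. ennreal (\<phi> t) \<partial>lebesgue) \<le> ennreal I"
proof -
  let ?\<phi> = "\<lambda>n t. ennreal (\<phi> t) * indicator {0..real n} t"
  have m: "?\<phi> n \<in> borel_measurable lebesgue" for n
  proof -
    have "(\<lambda>t. if t \<in> {0..} then \<phi> t else 0) \<in> borel_measurable lebesgue"
      using borel_measurable_if_I[OF meas] by simp
    then have "(\<lambda>t. ennreal (if t \<in> {0..} then \<phi> t else 0) * indicator {0..real n} t) \<in> borel_measurable lebesgue"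
      by (intro borel_measurable_times_ennreal measurable_compose[OF _ measurable_ennreal]
          borel_measurable_indicator) auto
    also have "(\<lambda>t. ennreal (if t \<in> {0..} then \<phi> t else 0) * indicator {0..real n} t) = ?\<phi> n"
      by (auto simp: indicator_def)
    finally show ?thesis .
  qed
  have inc: "incseq ?\<phi>"
    by (auto simp: incseq_def le_fun_def indicator_def)
  have sup: "(SUP n. ?\<phi> n t) = ennreal (\<phi> t) * indicator {0..} t" for t
  proof (cases "t \<ge> 0")
    case True
    obtain n where "t \<le> real n" using real_arch_simple by blast
    then have "ennreal (\<phi> t) \<le> (SUP n. ?\<phi> n t)"
      using True by (intro SUP_upper2[of n]) auto
    moreover have "(SUP n. ?\<phi> n t) \<le> ennreal (\<phi> t)"
      by (intro SUP_least) (auto simp: indicator_def)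
    ultimately show ?thesis using True by simp
  qed simp
  have "(\<integral>\<^sup>+t\<in>{0..}. ennreal (\<phi> t) \<partial>lebesgue) = (SUP n. \<integral>\<^sup>+t. ?\<phi> n t \<partial>lebesgue)"
    unfolding nn_integral_monotone_convergence_SUP[OF inc m, symmetric]
    by (intro nn_integral_cong) (simp only: sup SUP_apply)
  also have "\<dots> \<le> ennreal I"
  proof (rule SUP_least)
    fix n
    have "(\<phi> has_integral integral {0..real n} \<phi>) {0..real n}"
      using int(1)[of "real n"] by (simp add: has_integral_integral)
    from nn_integral_has_integral_lebesgue'[OF nn this]
    have "(\<integral>\<^sup>+t. ?\<phi> n t \<partial>lebesgue) = ennreal (integral {0..real n} \<phi>)"
      by (simp add: nn_integral_completion)
    then show "(\<integral>\<^sup>+t. ?\<phi> n t \<partial>lebesgue) \<le> ennreal I"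
      using int(2)[of "real n"] by (simp add: ennreal_leI)
  qed
  finally show ?thesis .
qed

text \<open>Confinement is needed only when the cost \<open>I\<close> is below \<open>v x0\<close>,
  and then \<open>K * I < \<rho>\<close> is inherited from \<open>K * v x0 < \<rho>\<close>.\<close>

lemma (in hjb_solution) v_le_cost:
  assumes K: "K > 0" "\<And>x w. \<rho> \<le> norm x \<Longrightarrow> norm x \<le> 2 * \<rho> \<Longrightarrow> norm (f x + g x *v w) \<le> K * \<kappa> x w"
    and "cball 0 (2 * \<rho>) \<subseteq> \<Omega>" and x0: "norm x0 < \<rho>" "K * v x0 < \<rho>" and u: "u \<in> U_inf"
  shows "ennreal (v x0) \<le> cost f g h R x0 u"
proof (cases rule: cost_cases[of f g h R x0 u])
  case (2 x)
  show ?thesis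
  proof (cases "cost f g h R x0 u")
    case (real I)
    then have I: "(\<integral>\<^sup>+t\<in>{0..}. ennreal (\<kappa> (x t) (u t)) \<partial>lebesgue) = ennreal I" "I \<ge> 0" using 2 by auto
    have "v x0 \<le> I"
    proof (rule ccontr)
      assume "\<not> v x0 \<le> I"
      then have "K * I \<le> K * v x0" using K(1) by simp
      then have "K * I < \<rho>" using x0(2) by simp
      then have "norm (x t) \<le> 2 * \<rho>" if "t \<ge> 0" for t
        using u finite_cost_stays_in_ball[OF 2(1) _ I K x0(1) _ that] by (simp add: U_inf_def)
      then have "v x0 \<le> I" by (rule v_le_cost_of_trajectory_in_\<Omega>[OF 2(1) u I assms(3)])
      then show False using \<open>\<not> v x0 \<le> I\<close> by simp
    qed
    then show ?thesis using real by (simp add: ennreal_leI)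
  qed simp
qed simp

context hjb_basin
begin

lemma closed_loop_caratheodory:
  assumes sol: "closed_loop_solution f g \<Omega> \<mu> x0 \<infinity> x" and x0: "x0 \<in> basin"
  shows "caratheodory_solution f g (\<lambda>t. \<mu> (x t)) x0 \<infinity> x" "(\<lambda>t. \<mu> (x t)) \<in> U_inf"
    "continuous_on {0..} x"
proof -
  have in_basin: "x t \<in> basin" if "t \<ge> 0" for t
    using closed_loop_solution_in_basin(1)[OF sol x0] that by simp
  have der: "(x has_vector_derivative f (x t) + g (x t) *v \<mu> (x t)) (at t within {0..})" if "t \<ge> 0" for t
    using sol that by (simp add: closed_loop_solution_def)
  then show cont: "continuous_on {0..} x"
    by (auto simp: continuous_on_eq_continuous_within intro: has_vector_derivative_continuous)
  obtain B where B: "B \<ge> 0" "\<And>y. norm y \<le> \<rho> \<Longrightarrow> norm (f y + g y *v \<mu> y) \<le> B"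
    using closed_loop_bound by blast
  have lip: "B-lipschitz_on {0..} x"
  proof (rule bounded_derivative_imp_lipschitz[OF _ _ _ B(1)])
    fix t :: real assume t: "t \<in> {0..}"
    show "(x has_derivative (\<lambda>h. h *\<^sub>R (f (x t) + g (x t) *v \<mu> (x t)))) (at t within {0..})"
      using der t by (simp add: has_vector_derivative_def)
    show "onorm (\<lambda>h. h *\<^sub>R (f (x t) + g (x t) *v \<mu> (x t))) \<le> B"
    proof (rule onorm_le)
      fix h :: real
      have "norm (f (x t) + g (x t) *v \<mu> (x t)) \<le> B"
        using in_basin[of t] t by (intro B(2)) (simp add: basin_def)
      from mult_left_mono[OF this norm_ge_zero[of h]]
      show "norm (h *\<^sub>R (f (x t) + g (x t) *v \<mu> (x t))) \<le> B * norm h" by (simp add: mult.commute)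
    qed
  qed simp
  have ac: "abs_cont_on 0 t x" for t
    by (rule lipschitz_on_imp_abs_cont_on[OF lipschitz_on_subset[OF lip]]) auto
  \<comment> \<open>A closed-loop solution has a one-sided derivative at 0, while the open-loop
    notion wants two-sided derivatives almost everywhere; the null set \<open>{0}\<close> is
    dropped.\<close>
  have "AE t in lebesgue. t \<noteq> (0::real)"
    by (rule AE_I'[of "{0}"]) (auto simp: negligible_iff_null_sets[symmetric])
  then have ae: "AE t in lebesgue. 0 \<le> t \<longrightarrow> (x has_vector_derivative f (x t) + g (x t) *v \<mu> (x t)) (at t)"
  proof (rule eventually_mono, intro impI)
    fix t :: real assume "t \<noteq> 0" "0 \<le> t"
    then show "(x has_vector_derivative f (x t) + g (x t) *v \<mu> (x t)) (at t)"
      using der[of t] at_within_interior[of t "{0..}"] by simp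
  qed
  show "caratheodory_solution f g (\<lambda>t. \<mu> (x t)) x0 \<infinity> x"
    using sol ac ae by (simp add: caratheodory_solution_def closed_loop_solution_def)
  have "bounded (\<mu> ` cball 0 \<rho>)"
    using continuous_on_subset[OF continuous_on_\<mu> cball_subset]
    by (intro compact_imp_bounded compact_continuous_image) auto
  then obtain C where C: "\<forall>y\<in>cball 0 \<rho>. norm (\<mu> y) \<le> C" by (auto simp: bounded_iff)
  have "norm (\<mu> (x t)) \<le> C" if "t \<ge> 0" for t
    using C in_basin[OF that] by (simp add: basin_def)
  then have "AE t in lebesgue_on {0..}. norm (\<mu> (x t)) \<le> C"
    by (intro AE_I2) simp
  moreover have "(\<lambda>t. \<mu> (x t)) \<in> borel_measurable (lebesgue_on {0..})"
    using in_basin basin_subset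
    by (intro continuous_imp_measurable_on_sets_lebesgue continuous_on_compose2[OF continuous_on_\<mu> cont]) auto
  ultimately show "(\<lambda>t. \<mu> (x t)) \<in> U_inf" by (auto simp: U_inf_def)
qed

text \<open>The cost up to time \<open>b\<close> is exactly \<open>v x0 - v (x b)\<close>, hence at
  most \<open>v x0\<close> for every \<open>b\<close>. That nothing is lost in the limit follows
  later from the lower bound.\<close>

lemma closed_loop_cost_le:
  assumes sol: "closed_loop_solution f g \<Omega> \<mu> x0 \<infinity> x" and x0: "x0 \<in> basin"
  shows "cost f g h R x0 (\<lambda>t. \<mu> (x t)) \<le> ennreal (v x0)"
proof -
  note car = closed_loop_caratheodory[OF sol x0]
  have meas: "(\<lambda>t. \<kappa> (x t) (\<mu> (x t))) \<in> borel_measurable (lebesgue_on {0..})"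
    using car(2) by (intro running_cost_measurable[OF car(3) cont_h]) (simp add: U_inf_def)
  have int: "((\<lambda>t. \<kappa> (x t) (\<mu> (x t))) has_integral v x0 - v (x b)) {0..b}" if "b \<ge> 0" for b
  proof -
    have "(x has_vector_derivative f (x r) + g (x r) *v \<mu> (x r)) (at r within {0..b})" if "r \<in> {0..b}" for r
      by (rule has_vector_derivative_within_subset[of _ _ _ "{0..}"])
        (use sol that in \<open>auto simp: closed_loop_solution_def\<close>)
    moreover have "x r \<in> \<Omega>" if "r \<in> {0..b}" for r using sol that by (simp add: closed_loop_solution_def)
    ultimately have "((\<lambda>t. \<kappa> (x t) (\<mu> (x t))) has_integral v (x 0) - v (x b)) {0..b}"
      by (rule closed_loop_dissipation[OF that])
    then show ?thesis using sol by (simp add: closed_loop_solution_def)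
  qed
  have le: "integral {0..b} (\<lambda>t. \<kappa> (x t) (\<mu> (x t))) \<le> v x0" if "b \<ge> 0" for b
  proof -
    have "x b \<in> \<Omega>" using sol that by (simp add: closed_loop_solution_def)
    then show ?thesis using integral_unique[OF int[OF that]] v_nonneg[of "x b"] by simp
  qed
  show ?thesis
    unfolding cost_eq_nn_integral[OF car(1,2) C1_f C1_g]
    by (rule nn_integral_atLeast_le[OF meas cost_nonneg has_integral_integrable[OF int] le])
qed

end

theorem (in hjb_solution) local_optimality:
  "\<exists>\<Omega>'. \<Omega>' \<subseteq> \<Omega> \<and> 0 \<in> interior \<Omega>' \<and> (\<forall>x\<in>\<Omega>'. ennreal (v x) = opt_value f g h R x) \<and>
    optimal_feedback f g h R \<Omega> \<mu> \<Omega>'"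
proof -
  obtain r where r: "r > 0" "cball 0 r \<subseteq> \<Omega>"
    using open_\<Omega> zero_in_\<Omega> open_contains_cball by blast
  \<comment> \<open>Half the radius, so that the whole annulus up to 2 \<rho> lies in
    \<Omega>.\<close>
  define \<rho> where "\<rho> = r / 2"
  have \<rho>: "\<rho> > 0" "cball 0 (2 * \<rho>) \<subseteq> \<Omega>" "cball 0 \<rho> \<subseteq> \<Omega>" "sphere 0 \<rho> \<subseteq> \<Omega>"
    using r by (auto simp: \<rho>_def)
  obtain K where K: "K > 0"
    "\<And>x w. \<rho> \<le> norm x \<Longrightarrow> norm x \<le> 2 * \<rho> \<Longrightarrow> norm (f x + g x *v w) \<le> K * \<kappa> x w"
    using speed_le_cost_on_annulus[OF \<rho>(1)] by blast
  have "sphere (0 :: real ^ 'n) \<rho> \<noteq> {}" using \<rho>(1) by simp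
  then obtain y where y: "y \<in> sphere 0 \<rho>" "\<And>z. z \<in> sphere 0 \<rho> \<Longrightarrow> v y \<le> v z"
    using continuous_attains_inf[OF compact_sphere _ continuous_on_subset[OF cont_v \<rho>(4)]] by blast
  have "v y > 0" using y(1) \<rho>(1,4) by (intro v_pos) auto
  \<comment> \<open>\<open>v y\<close> is the minimum on the sphere and gives the barrier; \<rho> /
    K gives \<open>K * v x < \<rho>\<close> on the basin, as \<open>v_le_cost\<close>
    requires.\<close>
  define c where "c = min (v y) (\<rho> / K)"
  have "c > 0" using \<open>v y > 0\<close> \<rho>(1) K(1) by (simp add: c_def)
  interpret hjb_basin f g h R \<Omega> v \<rho> c
    by unfold_locales (use \<rho> y in \<open>auto simp: c_def min_le_iff_disj\<close>)
  have lower: "ennreal (v x) \<le> cost f g h R x u" if "x \<in> basin" "u \<in> U_inf" for x u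
  proof (rule v_le_cost[OF K \<rho>(2) _ _ that(2)])
    show "norm x < \<rho>" using that(1) by (simp add: basin_def)
    have "v x < c" using that(1) by (simp add: basin_def)
    then have "v x < \<rho> / K" by (simp add: c_def)
    then show "K * v x < \<rho>" using K(1) by (simp add: field_simps)
  qed
  have opt: "opt_value f g h R x0 = ennreal (v x0)" "cost f g h R x0 (\<lambda>t. \<mu> (x t)) = ennreal (v x0)"
    if "x0 \<in> basin" "closed_loop_solution f g \<Omega> \<mu> x0 \<infinity> x" for x0 x
  proof -
    have U: "(\<lambda>t. \<mu> (x t)) \<in> U_inf" using closed_loop_caratheodory(2)[OF that(2,1)] .
    show c: "cost f g h R x0 (\<lambda>t. \<mu> (x t)) = ennreal (v x0)"
      using closed_loop_cost_le[OF that(2,1)] lower[OF that(1) U] by (rule antisym)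
    have "opt_value f g h R x0 \<le> ennreal (v x0)"
      unfolding opt_value_def c[symmetric] using U by (rule INF_lower)
    moreover have "ennreal (v x0) \<le> opt_value f g h R x0"
      unfolding opt_value_def using lower[OF that(1)] by (rule INF_greatest)
    ultimately show "opt_value f g h R x0 = ennreal (v x0)" by (rule antisym)
  qed
  show ?thesis
  proof (intro exI conjI ballI)
    show "basin \<subseteq> \<Omega>" by (rule basin_subset)
    have "open basin"
    proof -
      have "open (ball 0 \<rho> \<inter> v -` {..<c})"
        using ball_subset_cball \<rho>(3)
        by (intro continuous_open_preimage continuous_on_subset[OF cont_v]) auto
      then show ?thesis by (simp add: basin_def vimage_def Int_def)
    qed
    moreover have "0 \<in> basin" using \<rho>(1) \<open>c > 0\<close> v_0 by (simp add: basin_def)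
    ultimately show "0 \<in> interior basin" by (simp add: interior_open)
    \<comment> \<open>The value identity, too, needs an actual closed-loop trajectory, since the
      upper bound is attained along it.\<close>
    show "ennreal (v x) = opt_value f g h R x" if x: "x \<in> basin" for x
    proof -
      obtain z where "closed_loop_solution f g \<Omega> \<mu> x \<infinity> z"
        using global_closed_loop_solution[OF x] by blast
      then show ?thesis using opt(1)[OF x] by simp
    qed
    show "optimal_feedback f g h R \<Omega> \<mu> basin"
      unfolding optimal_feedback_def
    proof (intro conjI ballI allI impI)
      show "continuous_on \<Omega> \<mu>" by (rule continuous_on_\<mu>)
      show "basin \<subseteq> \<Omega>" by (rule basin_subset)
      fix x0 assume x0: "x0 \<in> basin"
      obtain z where z: "closed_loop_solution f g \<Omega> \<mu> x0 \<infinity> z"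
        using global_closed_loop_solution[OF x0] by blast
      then have "maximal_solution (closed_loop_solution f g \<Omega> \<mu> x0) \<infinity> z"
        by (rule maximal_solution_infinity)
      then show "\<exists>T x. maximal_solution (closed_loop_solution f g \<Omega> \<mu> x0) T x" by blast
      fix T x assume max: "maximal_solution (closed_loop_solution f g \<Omega> \<mu> x0) T x"
      then show T: "T = \<infinity>" using x0 by (rule maximal_closed_loop_solution_global)
      then have sol: "closed_loop_solution f g \<Omega> \<mu> x0 \<infinity> x" using max by (simp add: maximal_solution_def)
      then show "(\<lambda>t. \<mu> (x t)) \<in> U_inf" using x0 by (rule closed_loop_caratheodory(2))
      show "cost f g h R x0 (\<lambda>t. \<mu> (x t)) = opt_value f g h R x0"
        using opt[OF x0 sol] by simp
    qed
  qed
qed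

theorem theorem2p1:
  fixes f :: "real ^ 'n \<Rightarrow> real ^ 'n"
    and g :: "real ^ 'n \<Rightarrow> real ^ 'm ^ 'n"
    and h :: "real ^ 'n \<Rightarrow> real"
    and R :: "real ^ 'm ^ 'm"
    and \<Omega> :: "(real ^ 'n) set"
    and v :: "real ^ 'n \<Rightarrow> real"
  assumes "C1_on f UNIV" and "C1_on g UNIV" and "C1_on h UNIV"
    and "sym_pos_def R"
    and "f 0 = 0" and "h 0 = 0" and "\<And>x. x \<noteq> 0 \<Longrightarrow> h x > 0"
    and "domain_set \<Omega>" and "0 \<in> \<Omega>"
    and "\<And>x. x \<in> \<Omega> \<Longrightarrow> opt_value f g h R x < \<infinity>"
    and "C1_on (\<lambda>x. enn2real (opt_value f g h R x)) \<Omega>"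
    and "C1_on v \<Omega>"
    and "\<And>x. x \<in> \<Omega> \<Longrightarrow> v x \<ge> 0" and "v 0 = 0"
    and "\<And>x. x \<in> \<Omega> \<Longrightarrow>
           (f x + g x *v hjb_feedback g R v x) \<bullet> grad v x + h x
             + (weighted_norm R (hjb_feedback g R v x))\<^sup>2 = 0"
  shows "\<exists>\<Omega>'. \<Omega>' \<subseteq> \<Omega> \<and> 0 \<in> interior \<Omega>' \<and>
           (\<forall>x\<in>\<Omega>'. ennreal (v x) = opt_value f g h R x) \<and>
           optimal_feedback f g h R \<Omega> (hjb_feedback g R v) \<Omega>'"
proof -
  interpret hjb_solution f g h R \<Omega> v
    by unfold_locales (use assms in \<open>auto simp: domain_set_def intro: C1_on_imp_continuous_on\<close>)
  show ?thesis by (rule local_optimality)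
qed

end
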